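(* Suppose that $P$ is a simple $\mathfrak{D}$-module and $V$ is a simple $\mathfrak{b}$-module such that there is an $l\in\mathbb{Z}_{>0}$ satisfying: (1) $d_l$ acts injectively on $V$; (2) $d_iV=0$ for any $i>l$. Then $T(P,V)$ is a simple $\mathfrak{W}$-module.
   Context: All vector spaces and Lie algebras are over $\mathbb{C}$, and $\otimes=\otimes_{\mathbb{C}}$. Let $\mathfrak{W}=\mathrm{Der}_{\mathbb{C}}\,\mathbb{C}[x]$, the Lie algebra with basis $d_i=x^{i+1}\frac{\partial}{\partial x}$, $i\in\mathbb{Z}_{\ge -1}$, and bracket $[d_i,d_j]=(j-i)d_{i+j}$. Let $\mathfrak{b}=\mathrm{span}\{d_i\mid i\in\mathbb{Z}_{\ge 0}\}$, a Lie subalgebra of $\mathfrak{W}$. Let $\mathfrak{D}$ be the Weyl algebra of rank one, i.e. the associative $\mathbb{C}$-algebra generated by $x,\partial$ subject to the relation $[\partial,x]=1$. There is an (injective) algebra homomorphism $\phi:U(\mathfrak{W})\to\mathfrak{D}\otimes U(\mathfrak{b})$ with $$d_{-1}\mapsto\partial\otimes1,\qquad d_m\mapsto x^{m+1}\partial\otimes1+\sum_{r=0}^m\binom{m+1}{r+1}x^{m-r}\otimes d_r\quad(m\in\mathbb{Z}_{\ge0}).$$ For a $\mathfrak{D}$-module $P$ and a $\mathfrak{b}$-module $V$, $T(P,V)$ denotes the vector space $P\otimes V$ regarded as a $\mathfrak{W}$-module via $\phi$. *)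

theory Defs
  imports
    Complex_Main
    "HOL-Library.Poly_Mapping"
    "HOL-Computational_Algebra.Polynomial"
begin

class complex_vector = ab_group_add +
  fixes scaleC :: "complex \<Rightarrow> 'a \<Rightarrow> 'a"  (infixr "*\<^sub>C" 75)
  assumes scaleC_add_right: "a *\<^sub>C (x + y) = a *\<^sub>C x + a *\<^sub>C y"
    and scaleC_add_left: "(a + b) *\<^sub>C x = a *\<^sub>C x + b *\<^sub>C x"
    and scaleC_scaleC: "a *\<^sub>C (b *\<^sub>C x) = (a * b) *\<^sub>C x"
    and scaleC_one: "1 *\<^sub>C x = x"

global_interpretation cvec:
  vector_space "scaleC :: complex \<Rightarrow> 'a \<Rightarrow> 'a::complex_vector"
  by unfold_locales (fact scaleC_add_right scaleC_add_left scaleC_scaleC scaleC_one)+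

abbreviation csubspace :: "'a::complex_vector set \<Rightarrow> bool"
  where "csubspace \<equiv> cvec.subspace"

abbreviation cspan :: "'a::complex_vector set \<Rightarrow> 'a set"
  where "cspan \<equiv> cvec.span"

abbreviation clinear :: "('a::complex_vector \<Rightarrow> 'b::complex_vector) \<Rightarrow> bool"
  where "clinear \<equiv> Vector_Spaces.linear scaleC scaleC"

definition cbilinear ::
    "('a::complex_vector \<Rightarrow> 'b::complex_vector \<Rightarrow> 'c::complex_vector) \<Rightarrow> bool"
  where "cbilinear B \<longleftrightarrow> (\<forall>y. clinear (\<lambda>x. B x y)) \<and> (\<forall>x. clinear (B x))"

lemma clinearI:
  assumes "\<And>x y. f (x + y) = f x + f y" and "\<And>c x. f (c *\<^sub>C x) = c *\<^sub>C f x"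
  shows "clinear f"
  by unfold_locales (use assms in auto)

instantiation complex :: complex_vector
begin
definition scaleC_complex :: "complex \<Rightarrow> complex \<Rightarrow> complex"
  where "scaleC_complex c z = c * z"
instance
  by standard (simp_all add: scaleC_complex_def algebra_simps)
end

instantiation poly_mapping :: (type, complex_vector) complex_vector
begin
lift_definition scaleC_poly_mapping :: "complex \<Rightarrow> ('a \<Rightarrow>\<^sub>0 'b) \<Rightarrow> 'a \<Rightarrow>\<^sub>0 'b"
  is "\<lambda>c f k. c *\<^sub>C f k"
  by (erule rev_finite_subset) auto
instance
  by standard (transfer, simp add: scaleC_add_right scaleC_add_left scaleC_scaleC scaleC_one)+
end

lemma lookup_scaleC [simp]: "Poly_Mapping.lookup (c *\<^sub>C f) k = c *\<^sub>C Poly_Mapping.lookup f k"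
  by transfer simp

definition tensor_relators ::
    "(('a::complex_vector \<times> 'b::complex_vector) \<Rightarrow>\<^sub>0 complex) set"
  where "tensor_relators =
    {Poly_Mapping.single (x + x', y) 1 - Poly_Mapping.single (x, y) 1
       - Poly_Mapping.single (x', y) 1 | x x' y. True} \<union>
    {Poly_Mapping.single (x, y + y') 1 - Poly_Mapping.single (x, y) 1
       - Poly_Mapping.single (x, y') 1 | x y y'. True} \<union>
    {Poly_Mapping.single (c *\<^sub>C x, y) 1 - c *\<^sub>C Poly_Mapping.single (x, y) 1 | c x y. True} \<union>
    {Poly_Mapping.single (x, c *\<^sub>C y) 1 - c *\<^sub>C Poly_Mapping.single (x, y) 1 | c x y. True}"

definition congruent_mod :: "'a::complex_vector set \<Rightarrow> 'a \<Rightarrow> 'a \<Rightarrow> bool"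
  where "congruent_mod R f g \<longleftrightarrow> f - g \<in> cspan R"

lemma equivp_congruent_mod: "equivp (congruent_mod R)"
proof (rule equivpI)
  show "reflp (congruent_mod R)"
    by (auto simp: reflp_def congruent_mod_def cvec.span_zero)
  show "symp (congruent_mod R)"
    unfolding symp_def congruent_mod_def by (metis cvec.span_neg minus_diff_eq)
  show "transp (congruent_mod R)"
  proof (rule transpI)
    fix f g h assume "congruent_mod R f g" "congruent_mod R g h"
    then have "(f - g) + (g - h) \<in> cspan R"
      unfolding congruent_mod_def by (rule cvec.span_add)
    then show "congruent_mod R f h" by (simp add: congruent_mod_def)
  qed
qed

lemma congruent_mod_refl: "congruent_mod R f f"
  using equivp_congruent_mod by (rule equivp_reflp)

lemma congruent_mod_add:
  assumes "congruent_mod R f f'" "congruent_mod R g g'"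
  shows "congruent_mod R (f + g) (f' + g')"
  using cvec.span_add[OF assms[unfolded congruent_mod_def]]
  by (simp add: congruent_mod_def add_diff_add)

lemma congruent_mod_diff:
  assumes "congruent_mod R f f'" "congruent_mod R g g'"
  shows "congruent_mod R (f - g) (f' - g')"
proof -
  have "(f - g) - (f' - g') = (f - f') - (g - g')"
    by (simp add: algebra_simps)
  then show ?thesis
    using cvec.span_diff[OF assms[unfolded congruent_mod_def]]
    by (simp only: congruent_mod_def)
qed

lemma congruent_mod_uminus:
  "congruent_mod R f f' \<Longrightarrow> congruent_mod R (- f) (- f')"
  using congruent_mod_diff[OF congruent_mod_refl[of R 0]] by fastforce

lemma congruent_mod_scaleC:
  assumes "congruent_mod R f f'"
  shows "congruent_mod R (c *\<^sub>C f) (c *\<^sub>C f')"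
  using cvec.span_scale[OF assms[unfolded congruent_mod_def], of c]
  by (simp add: congruent_mod_def cvec.scale_right_diff_distrib)

quotient_type (overloaded) ('a, 'b) tensor =
    "('a::complex_vector \<times> 'b::complex_vector) \<Rightarrow>\<^sub>0 complex" / "congruent_mod tensor_relators"
  by (rule equivp_congruent_mod)

instantiation tensor :: (complex_vector, complex_vector) complex_vector
begin
lift_definition zero_tensor :: "('a, 'b) tensor" is 0 .
lift_definition plus_tensor :: "('a, 'b) tensor \<Rightarrow> ('a, 'b) tensor \<Rightarrow> ('a, 'b) tensor"
  is "(+)" by (rule congruent_mod_add)
lift_definition minus_tensor :: "('a, 'b) tensor \<Rightarrow> ('a, 'b) tensor \<Rightarrow> ('a, 'b) tensor"
  is "(-)" by (rule congruent_mod_diff)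
lift_definition uminus_tensor :: "('a, 'b) tensor \<Rightarrow> ('a, 'b) tensor"
  is uminus by (rule congruent_mod_uminus)
lift_definition scaleC_tensor :: "complex \<Rightarrow> ('a, 'b) tensor \<Rightarrow> ('a, 'b) tensor"
  is scaleC by (rule congruent_mod_scaleC)
instance
  by standard
    (transfer, simp add: congruent_mod_refl algebra_simps
       scaleC_add_right scaleC_add_left scaleC_scaleC scaleC_one)+
end

lift_definition pure_tensor ::
    "'a::complex_vector \<Rightarrow> 'b::complex_vector \<Rightarrow> ('a, 'b) tensor"  (infixl "\<otimes>\<^sub>C" 70)
  is "\<lambda>x y. Poly_Mapping.single (x, y) 1" .

lemma cbilinear_pure_tensor: "cbilinear (\<otimes>\<^sub>C)"
proof -
  have *: "congruent_mod tensor_relators f (g + h)" if "f - g - h \<in> tensor_relators"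
    for f g h :: "('a \<times> 'b) \<Rightarrow>\<^sub>0 complex"
    using cvec.span_base[OF that] by (simp add: congruent_mod_def diff_diff_eq)
  have **: "congruent_mod tensor_relators f g" if "f - g \<in> tensor_relators"
    for f g :: "('a \<times> 'b) \<Rightarrow>\<^sub>0 complex"
    using cvec.span_base[OF that] by (simp add: congruent_mod_def)
  show ?thesis
    unfolding cbilinear_def
    by (intro conjI allI clinearI; transfer; (rule * **)?;
        unfold tensor_relators_def; blast)
qed

text \<open>
  The map out of the tensor product induced by a bilinear map (computed on an arbitrary
  representative; meaningful only for bilinear \<open>B\<close>, see \<open>tensor_lift_pure\<close> and
  \<open>clinear_tensor_lift\<close>).
\<close>

definition free_extension :: "('a \<Rightarrow> 'c::complex_vector) \<Rightarrow> ('a \<Rightarrow>\<^sub>0 complex) \<Rightarrow> 'c"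
  where "free_extension F f =
    (\<Sum>k\<in>Poly_Mapping.keys f. Poly_Mapping.lookup f k *\<^sub>C F k)"

definition tensor_lift ::
    "('a::complex_vector \<Rightarrow> 'b::complex_vector \<Rightarrow> 'c::complex_vector) \<Rightarrow> ('a, 'b) tensor \<Rightarrow> 'c"
  where "tensor_lift B t = free_extension (\<lambda>(x, y). B x y) (rep_tensor t)"

lemma free_extension_superset:
  assumes "finite A" "Poly_Mapping.keys f \<subseteq> A"
  shows "free_extension F f = (\<Sum>k\<in>A. Poly_Mapping.lookup f k *\<^sub>C F k)"
  unfolding free_extension_def
  using assms by (intro sum.mono_neutral_left) (auto simp: in_keys_iff)

lemma clinear_free_extension: "clinear (free_extension F)"
proof (rule clinearI)
  fix f g :: "'a \<Rightarrow>\<^sub>0 complex" and c :: complex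
  let ?A = "Poly_Mapping.keys f \<union> Poly_Mapping.keys g"
  have "free_extension F (f + g) = (\<Sum>k\<in>?A. Poly_Mapping.lookup (f + g) k *\<^sub>C F k)"
    by (rule free_extension_superset) (auto simp: in_keys_iff lookup_add)
  also have "\<dots> = free_extension F f + free_extension F g"
    by (simp add: lookup_add scaleC_add_left sum.distrib free_extension_superset[of ?A])
  finally show "free_extension F (f + g) = free_extension F f + free_extension F g" .
  have "free_extension F (c *\<^sub>C f) =
      (\<Sum>k\<in>Poly_Mapping.keys f. Poly_Mapping.lookup (c *\<^sub>C f) k *\<^sub>C F k)"
    by (rule free_extension_superset) (auto simp: in_keys_iff scaleC_complex_def)
  also have "\<dots> = c *\<^sub>C free_extension F f"
    by (simp add: free_extension_def cvec.scale_sum_right scaleC_complex_def)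
  finally show "free_extension F (c *\<^sub>C f) = c *\<^sub>C free_extension F f" .
qed

lemma free_extension_single: "free_extension F (Poly_Mapping.single k c) = c *\<^sub>C F k"
  by (cases "c = 0") (simp_all add: free_extension_def)

lemma free_extension_congruent:
  fixes B :: "'a::complex_vector \<Rightarrow> 'b::complex_vector \<Rightarrow> 'c::complex_vector"
  assumes B: "cbilinear B" and "congruent_mod tensor_relators f g"
  shows "free_extension (\<lambda>(x, y). B x y) f = free_extension (\<lambda>(x, y). B x y) g"
proof -
  let ?E = "free_extension (\<lambda>(x, y). B x y)"
  interpret E: Vector_Spaces.linear scaleC scaleC ?E by (rule clinear_free_extension)
  have l: "clinear (\<lambda>x. B x y)" and r: "clinear (B x)" for x y
    using B by (auto simp: cbilinear_def)
  have "?E h = 0" if "h \<in> tensor_relators" for h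
    using that unfolding tensor_relators_def
    by (auto simp: E.diff E.scale free_extension_single scaleC_one
        linear_iff_module_hom module_hom.add[OF l[unfolded linear_iff_module_hom]]
        module_hom.add[OF r[unfolded linear_iff_module_hom]]
        module_hom.scale[OF l[unfolded linear_iff_module_hom]]
        module_hom.scale[OF r[unfolded linear_iff_module_hom]])
  then have "?E h = 0" if "h \<in> cspan tensor_relators" for h
    using that E.eq_0_on_span by blast
  then show ?thesis
    using assms(2) by (metis congruent_mod_def E.diff eq_iff_diff_eq_0)
qed

lemma tensor_lift_abs:
  assumes "cbilinear B"
  shows "tensor_lift B (abs_tensor f) = free_extension (\<lambda>(x, y). B x y) f"
  unfolding tensor_lift_def
  by (rule free_extension_congruent[OF assms])
    (rule Quotient3_rep_abs[OF Quotient3_tensor congruent_mod_refl])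

lemma tensor_lift_pure:
  assumes "cbilinear B"
  shows "tensor_lift B (x \<otimes>\<^sub>C y) = B x y"
  by (simp add: pure_tensor.abs_eq tensor_lift_abs[OF assms] free_extension_single scaleC_one)

lemma clinear_tensor_lift:
  assumes "cbilinear B"
  shows "clinear (tensor_lift B)"
proof -
  interpret E: Vector_Spaces.linear scaleC scaleC "free_extension (\<lambda>(x, y). B x y)"
    by (rule clinear_free_extension)
  have "tensor_lift B (s + t) = tensor_lift B s + tensor_lift B t" for s t
    by (induction s, induction t)
      (simp add: plus_tensor.abs_eq tensor_lift_abs[OF assms] E.add)
  moreover have "tensor_lift B (c *\<^sub>C t) = c *\<^sub>C tensor_lift B t" for c t
    by (induction t) (simp add: scaleC_tensor.abs_eq tensor_lift_abs[OF assms] E.scale)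
  ultimately show ?thesis by (intro clinearI)
qed

definition tensor_map ::
    "('a::complex_vector \<Rightarrow> 'c::complex_vector) \<Rightarrow> ('b::complex_vector \<Rightarrow> 'd::complex_vector)
      \<Rightarrow> ('a, 'b) tensor \<Rightarrow> ('c, 'd) tensor"
  where "tensor_map f g = tensor_lift (\<lambda>x y. f x \<otimes>\<^sub>C g y)"

lemma cbilinear_tensor_map:
  assumes "clinear f" "clinear g"
  shows "cbilinear (\<lambda>x y. f x \<otimes>\<^sub>C g y)"
proof -
  interpret f: Vector_Spaces.linear scaleC scaleC f by fact
  interpret g: Vector_Spaces.linear scaleC scaleC g by fact
  have l: "clinear (\<lambda>x. x \<otimes>\<^sub>C y)" and r: "clinear ((\<otimes>\<^sub>C) x)" for x :: 'b and y :: 'd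
    using cbilinear_pure_tensor unfolding cbilinear_def by blast+
  show ?thesis
    unfolding cbilinear_def
    by (intro conjI allI clinearI)
      (simp_all add: f.add f.scale g.add g.scale
        module_hom.add[OF l[unfolded linear_iff_module_hom]]
        module_hom.scale[OF l[unfolded linear_iff_module_hom]]
        module_hom.add[OF r[unfolded linear_iff_module_hom]]
        module_hom.scale[OF r[unfolded linear_iff_module_hom]])
qed

lemma tensor_map_pure:
  assumes "clinear f" "clinear g"
  shows "tensor_map f g (x \<otimes>\<^sub>C y) = f x \<otimes>\<^sub>C g y"
  unfolding tensor_map_def by (rule tensor_lift_pure[OF cbilinear_tensor_map[OF assms]])

lemma clinear_tensor_map:
  assumes "clinear f" "clinear g"
  shows "clinear (tensor_map f g)"
  unfolding tensor_map_def by (rule clinear_tensor_lift[OF cbilinear_tensor_map[OF assms]])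

datatype weyl_gen = Gen_x | Gen_del

datatype weyl_word = Word (letters: "weyl_gen list")

instantiation weyl_word :: monoid_add
begin
definition zero_weyl_word :: weyl_word where "0 = Word []"
definition plus_weyl_word :: "weyl_word \<Rightarrow> weyl_word \<Rightarrow> weyl_word"
  where "v + w = Word (letters v @ letters w)"
instance
  by standard (simp_all add: zero_weyl_word_def plus_weyl_word_def)
end

text \<open>
  As words form a monoid under concatenation (written additively), the type
  \<open>weyl_word \<Rightarrow>\<^sub>0 complex\<close> with the convolution product is the free associative algebra
  on two generators.
\<close>

definition free_gen :: "weyl_gen \<Rightarrow> weyl_word \<Rightarrow>\<^sub>0 complex"
  where "free_gen g = Poly_Mapping.single (Word [g]) 1"

text \<open>The linear span of this set is the two-sided ideal generated by \<open>\<partial>x - x\<partial> - 1\<close>.\<close>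

definition weyl_relators :: "(weyl_word \<Rightarrow>\<^sub>0 complex) set"
  where "weyl_relators =
    {a * (free_gen Gen_del * free_gen Gen_x - free_gen Gen_x * free_gen Gen_del - 1) * b
      | a b. True}"

lemma scaleC_eq_single_mult:
  fixes f :: "weyl_word \<Rightarrow>\<^sub>0 complex"
  shows "c *\<^sub>C f = Poly_Mapping.single 0 c * f"
proof -
  have "c *\<^sub>C f = Poly_Mapping.map ((*) c) f"
    by (rule poly_mapping_eqI) (simp add: scaleC_complex_def map.rep_eq when_def)
  then show ?thesis by (simp add: mult_map_scale_conv_mult)
qed

lemma scaleC_eq_mult_single:
  fixes f :: "weyl_word \<Rightarrow>\<^sub>0 complex"
  shows "c *\<^sub>C f = f * Poly_Mapping.single 0 c"
proof (induction f rule: update_induct)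
  case const
  then show ?case by simp
next
  case (update f a b)
  have "Poly_Mapping.update a b f = f + Poly_Mapping.single a b"
    using update(1) by (intro poly_mapping_eqI)
      (auto simp: lookup_update lookup_add lookup_single when_def in_keys_iff)
  moreover have "c *\<^sub>C Poly_Mapping.single a b = Poly_Mapping.single a b * Poly_Mapping.single 0 c"
    by (simp add: scaleC_eq_single_mult mult_single mult.commute)
  ultimately show ?case
    using update(3) by (simp add: scaleC_add_right distrib_right)
qed

lemma weyl_scaleC_mult_left:
  fixes f g :: "weyl_word \<Rightarrow>\<^sub>0 complex"
  shows "(c *\<^sub>C f) * g = c *\<^sub>C (f * g)"
  by (simp add: scaleC_eq_single_mult mult.assoc)

lemma weyl_scaleC_mult_right:
  fixes f g :: "weyl_word \<Rightarrow>\<^sub>0 complex"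
  shows "f * (c *\<^sub>C g) = c *\<^sub>C (f * g)"
  by (simp add: scaleC_eq_mult_single mult.assoc)

lemma weyl_ideal_mult_left: "f \<in> cspan weyl_relators \<Longrightarrow> g * f \<in> cspan weyl_relators"
proof (induction rule: cvec.span_induct_alt)
  case (step c x y)
  from step(1) have "g * x \<in> weyl_relators"
    unfolding weyl_relators_def by (auto, metis mult.assoc)
  then show ?case
    using step(2) by (simp add: distrib_left weyl_scaleC_mult_right cvec.span_add
        cvec.span_scale cvec.span_base)
qed (simp add: cvec.span_zero)

lemma weyl_ideal_mult_right: "f \<in> cspan weyl_relators \<Longrightarrow> f * g \<in> cspan weyl_relators"
proof (induction rule: cvec.span_induct_alt)
  case (step c x y)
  from step(1) have "x * g \<in> weyl_relators"
    unfolding weyl_relators_def by (auto, metis mult.assoc)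
  then show ?case
    using step(2) by (simp add: distrib_right weyl_scaleC_mult_left cvec.span_add
        cvec.span_scale cvec.span_base)
qed (simp add: cvec.span_zero)

quotient_type weyl = "weyl_word \<Rightarrow>\<^sub>0 complex" / "congruent_mod weyl_relators"
  by (rule equivp_congruent_mod)

instantiation weyl :: "{complex_vector, ring, monoid_mult}"
begin
lift_definition zero_weyl :: weyl is 0 .
lift_definition one_weyl :: weyl is 1 .
lift_definition plus_weyl :: "weyl \<Rightarrow> weyl \<Rightarrow> weyl" is "(+)" by (rule congruent_mod_add)
lift_definition minus_weyl :: "weyl \<Rightarrow> weyl \<Rightarrow> weyl" is "(-)" by (rule congruent_mod_diff)
lift_definition uminus_weyl :: "weyl \<Rightarrow> weyl" is uminus by (rule congruent_mod_uminus)
lift_definition scaleC_weyl :: "complex \<Rightarrow> weyl \<Rightarrow> weyl" is scaleC by (rule congruent_mod_scaleC)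
lift_definition times_weyl :: "weyl \<Rightarrow> weyl \<Rightarrow> weyl" is "(*)"
proof -
  fix f f' g g' :: "weyl_word \<Rightarrow>\<^sub>0 complex"
  assume "congruent_mod weyl_relators f f'" "congruent_mod weyl_relators g g'"
  then have "(f - f') * g + f' * (g - g') \<in> cspan weyl_relators"
    unfolding congruent_mod_def
    by (intro cvec.span_add weyl_ideal_mult_left weyl_ideal_mult_right)
  then show "congruent_mod weyl_relators (f * g) (f' * g')"
    by (simp add: congruent_mod_def algebra_simps)
qed
instance
  by standard
    (transfer, simp add: congruent_mod_refl algebra_simps
       scaleC_add_right scaleC_add_left scaleC_scaleC scaleC_one)+
end

lift_definition weyl_x :: weyl is "free_gen Gen_x" .
lift_definition weyl_del :: weyl is "free_gen Gen_del" .

lemma weyl_relation: "weyl_del * weyl_x - weyl_x * weyl_del = 1"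
proof (transfer, unfold congruent_mod_def, rule cvec.span_base)
  show "free_gen Gen_del * free_gen Gen_x - free_gen Gen_x * free_gen Gen_del - 1 \<in> weyl_relators"
    unfolding weyl_relators_def by (rule CollectI, rule exI[of _ 1], rule exI[of _ 1]) simp
qed

definition weyl_module :: "(weyl \<Rightarrow> 'p::complex_vector \<Rightarrow> 'p) \<Rightarrow> bool"
  where "weyl_module act \<longleftrightarrow>
    cbilinear act \<and> (\<forall>p. act 1 p = p) \<and> (\<forall>a b p. act (a * b) p = act a (act b p))"

definition simple_weyl_module :: "(weyl \<Rightarrow> 'p::complex_vector \<Rightarrow> 'p) \<Rightarrow> bool"
  where "simple_weyl_module act \<longleftrightarrow>
    weyl_module act \<and> (UNIV :: 'p set) \<noteq> {0} \<and>
    (\<forall>N. csubspace N \<and> (\<forall>a. \<forall>p\<in>N. act a p \<in> N) \<longrightarrow> N = {0} \<or> N = UNIV)"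

typedef witt =
  "{D :: complex poly \<Rightarrow> complex poly.
     (\<forall>p q. D (p + q) = D p + D q) \<and> (\<forall>c p. D (smult c p) = smult c (D p)) \<and>
     (\<forall>p q. D (p * q) = D p * q + p * D q)}"
  morphisms derivation Abs_witt
  by (rule exI[of _ "\<lambda>_. 0"]) simp

setup_lifting type_definition_witt

instantiation witt :: complex_vector
begin
lift_definition zero_witt :: witt is "\<lambda>_. 0" by simp
lift_definition plus_witt :: "witt \<Rightarrow> witt \<Rightarrow> witt" is "\<lambda>D E p. D p + E p"
  by (simp add: algebra_simps smult_add_right)
lift_definition minus_witt :: "witt \<Rightarrow> witt \<Rightarrow> witt" is "\<lambda>D E p. D p - E p"
  by (simp add: algebra_simps smult_diff_right)
lift_definition uminus_witt :: "witt \<Rightarrow> witt" is "\<lambda>D p. - D p"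
  by (simp add: algebra_simps)
lift_definition scaleC_witt :: "complex \<Rightarrow> witt \<Rightarrow> witt" is "\<lambda>c D p. smult c (D p)"
  by (simp add: algebra_simps smult_add_right)
instance
  by standard (transfer, simp add: fun_eq_iff smult_add_right smult_add_left)+
end

lift_definition bracket :: "witt \<Rightarrow> witt \<Rightarrow> witt" is "\<lambda>D E p. D (E p) - E (D p)"
  by (simp add: algebra_simps smult_diff_right)

text \<open>\<open>wd i\<close> is \<open>d\<^sub>i = x\<^sup>i\<^sup>+\<^sup>1 d/dx\<close>; only indices \<open>i \<ge> -1\<close> are meaningful.\<close>

lift_definition wd :: "int \<Rightarrow> witt" is "\<lambda>i p. monom 1 (nat (i + 1)) * pderiv p"
  by (simp add: pderiv_add pderiv_smult pderiv_mult algebra_simps)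

definition borel_b :: "witt set"
  where "borel_b = cspan {wd i | i. i \<ge> 0}"

text \<open>
  Coefficient of \<open>x\<^sup>k\<close> in \<open>D x\<close>, i.e. coordinate of \<open>D\<close> at the basis vector \<open>d\<close> with index
  \<open>k - 1\<close> (lemma \<open>witt_expansion\<close>).
\<close>

definition wcoeff :: "witt \<Rightarrow> nat \<Rightarrow> complex"
  where "wcoeff D k = coeff (derivation D [:0, 1:]) k"

definition wdegree :: "witt \<Rightarrow> nat"
  where "wdegree D = degree (derivation D [:0, 1:])"

lemma derivation_eq: "derivation D p = derivation D [:0, 1:] * pderiv p"
proof (induction p)
  case 0
  have "derivation D (0 + 0) = derivation D 0 + derivation D 0"
    using derivation[of D] by blast
  then show ?case by simp
next
  case (pCons a p)
  note der = derivation[of D, simplified]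
  have "derivation D (1 * 1) = derivation D 1 * 1 + 1 * derivation D 1"
    using der by blast
  then have "derivation D 1 = 0" by simp
  moreover have "[:a:] = smult a 1" by simp
  ultimately have const: "derivation D [:a:] = 0"
    using der by (metis smult_0_right)
  have "pCons a p = [:a:] + [:0, 1:] * p" by simp
  then have "derivation D (pCons a p) =
      derivation D [:a:] + (derivation D [:0, 1:] * p + [:0, 1:] * derivation D p)"
    using der by metis
  also have "\<dots> = derivation D [:0, 1:] * pderiv (pCons a p)"
    using pCons(2) const by (simp add: pderiv_pCons algebra_simps)
  finally show ?case .
qed

lemma derivation_sum: "derivation (sum F A) p = (\<Sum>k\<in>A. derivation (F k) p)"
  by (induction A rule: infinite_finite_induct)
    (simp_all add: zero_witt.rep_eq plus_witt.rep_eq)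

lemma witt_expansion: "D = (\<Sum>k\<le>wdegree D. wcoeff D k *\<^sub>C wd (int k - 1))"
proof -
  let ?w = "derivation D [:0, 1:]"
  have "derivation D p = derivation (\<Sum>k\<le>wdegree D. wcoeff D k *\<^sub>C wd (int k - 1)) p" for p
  proof -
    have "derivation (\<Sum>k\<le>wdegree D. wcoeff D k *\<^sub>C wd (int k - 1)) p =
        (\<Sum>k\<le>degree ?w. monom (coeff ?w k) k) * pderiv p"
      by (simp add: derivation_sum scaleC_witt.rep_eq wd.rep_eq wcoeff_def wdegree_def
          sum_distrib_right smult_monom flip: mult_smult_left)
    then show ?thesis
      using derivation_eq[of D p] by (simp add: poly_as_sum_of_monoms)
  qed
  then show ?thesis by (simp add: derivation_inject[symmetric] fun_eq_iff)
qed

lemma bracket_wd: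
  assumes "i \<ge> -1" "j \<ge> -1"
  shows "bracket (wd i) (wd j) = of_int (j - i) *\<^sub>C wd (i + j)"
proof -
  define m n where "m = nat (i + 1)" and "n = nat (j + 1)"
  have ij: "i = int m - 1" "j = int n - 1" using assms by (auto simp: m_def n_def)
  have *: "monom 1 a * pderiv (monom 1 b) = smult (of_nat b) (monom 1 (a + b - 1) :: complex poly)"
    for a b
    by (cases b) (simp_all add: pderiv_monom mult_monom smult_monom)
  have "derivation (bracket (wd i) (wd j)) p = derivation (of_int (j - i) *\<^sub>C wd (i + j)) p" for p
  proof -
    have "derivation (bracket (wd i) (wd j)) p =
        (monom 1 m * pderiv (monom 1 n) - monom 1 n * pderiv (monom 1 m)) * pderiv p"
      by (simp add: bracket.rep_eq wd.rep_eq ij pderiv_mult algebra_simps)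
    also have "\<dots> = smult (of_int (j - i)) (monom 1 (m + n - 1)) * pderiv p"
      by (simp add: * ij add.commute smult_diff_left)
    also have "m + n - 1 = nat (i + j + 1)"
      by (simp add: ij)
    finally show ?thesis by (simp add: scaleC_witt.rep_eq wd.rep_eq)
  qed
  then show ?thesis by (simp add: derivation_inject[symmetric] fun_eq_iff)
qed

text \<open>Values of \<open>rho\<close> outside the subalgebra \<open>g\<close> are irrelevant.\<close>

definition lie_module :: "witt set \<Rightarrow> (witt \<Rightarrow> 'v::complex_vector \<Rightarrow> 'v) \<Rightarrow> bool"
  where "lie_module g rho \<longleftrightarrow>
    (\<forall>D\<in>g. clinear (rho D)) \<and>
    (\<forall>D\<in>g. \<forall>E\<in>g. \<forall>v. rho (D + E) v = rho D v + rho E v) \<and>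
    (\<forall>c. \<forall>D\<in>g. \<forall>v. rho (c *\<^sub>C D) v = c *\<^sub>C rho D v) \<and>
    (\<forall>D\<in>g. \<forall>E\<in>g. \<forall>v. rho (bracket D E) v = rho D (rho E v) - rho E (rho D v))"

definition simple_lie_module :: "witt set \<Rightarrow> (witt \<Rightarrow> 'v::complex_vector \<Rightarrow> 'v) \<Rightarrow> bool"
  where "simple_lie_module g rho \<longleftrightarrow>
    lie_module g rho \<and> (UNIV :: 'v set) \<noteq> {0} \<and>
    (\<forall>N. csubspace N \<and> (\<forall>D\<in>g. \<forall>v\<in>N. rho D v \<in> N) \<longrightarrow> N = {0} \<or> N = UNIV)"

text \<open>
  \<open>phi_action act rho m\<close> is the operator by which \<open>\<phi>(d\<^sub>m)\<close> acts on \<open>P \<otimes> V\<close>, where \<open>a \<otimes> u\<close>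
  acts as the tensor product of the actions of \<open>a\<close> on \<open>P\<close> and of \<open>u\<close> on \<open>V\<close>.
\<close>

definition phi_action ::
    "(weyl \<Rightarrow> 'p::complex_vector \<Rightarrow> 'p) \<Rightarrow> (witt \<Rightarrow> 'v::complex_vector \<Rightarrow> 'v)
      \<Rightarrow> int \<Rightarrow> ('p, 'v) tensor \<Rightarrow> ('p, 'v) tensor"
  where "phi_action act rho m t =
    (if m = -1 then tensor_map (act weyl_del) id t
     else tensor_map (act (weyl_x ^ (nat m + 1) * weyl_del)) id t
        + (\<Sum>r = 0..nat m. of_nat ((nat m + 1) choose (r + 1)) *\<^sub>C
             tensor_map (act (weyl_x ^ (nat m - r))) (rho (wd (int r))) t))"

text \<open>The linear extension of \<open>d\<^sub>m \<mapsto> \<phi>(d\<^sub>m)\<close> to all derivations.\<close>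

definition T_action ::
    "(weyl \<Rightarrow> 'p::complex_vector \<Rightarrow> 'p) \<Rightarrow> (witt \<Rightarrow> 'v::complex_vector \<Rightarrow> 'v)
      \<Rightarrow> witt \<Rightarrow> ('p, 'v) tensor \<Rightarrow> ('p, 'v) tensor"
  where "T_action act rho D t =
    (\<Sum>k\<le>wdegree D. wcoeff D k *\<^sub>C phi_action act rho (int k - 1) t)"

lemma T_action_wd:
  assumes "m \<ge> -1"
  shows "T_action act rho (wd m) = phi_action act rho m"
proof
  fix t
  have w: "derivation (wd m) [:0, 1:] = monom 1 (nat (m + 1))"
    by (simp add: wd.rep_eq pderiv_pCons)
  have "T_action act rho (wd m) t =
      (\<Sum>k\<le>nat (m + 1). if k = nat (m + 1) then phi_action act rho (int k - 1) t else 0)"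
    unfolding T_action_def wdegree_def wcoeff_def w
    by (intro sum.cong) (auto simp: degree_monom_eq scaleC_one)
  then show "T_action act rho (wd m) t = phi_action act rho m t"
    using assms by simp
qed

end

theory Submission
  imports
    Defs
    "HOL-Computational_Algebra.Fundamental_Theorem_Algebra"
    "HOL-Analysis.Continuum_Not_Denumerable"
begin

text \<open>
  Write \<open>M = x \<otimes> 1\<close>, \<open>e\<^sub>0 = \<partial> \<otimes> 1\<close> and \<open>e\<^sub>r\<^sub>+\<^sub>1 = 1 \<otimes> d\<^sub>r\<close> for the operators on \<open>P \<otimes> V\<close>. Then
  \<open>\<phi>(d\<^sub>k\<^sub>-\<^sub>1) = X\<^sub>k\<close>, where \<open>X\<^sub>k\<close> is the sum over \<open>r \<le> k\<close> of \<open>(k choose r) M\<^sup>k\<^sup>-\<^sup>r e\<^sub>r\<close>. That these operators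
  represent the Witt algebra is a consequence of the commutation rules of \<open>M\<close> and the \<open>e\<^sub>r\<close> and of
  Vandermonde's convolution (\<open>X_commutator\<close>).

  For simplicity, let \<open>N\<close> be a nonzero submodule. In the normally ordered product \<open>X\<^sub>j X\<^sub>k\<close> with
  \<open>j + k\<close> fixed, the coefficients are polynomials in \<open>j\<close>. The term with \<open>d\<^sub>l\<^sup>2\<close> has degree \<open>2 l + 2\<close>
  and all other terms have lower degree, because \<open>l > 0\<close> and \<open>d\<^sub>i\<close> vanishes on \<open>V\<close> for \<open>i > l\<close>. A finite
  difference of order \<open>2 l + 2\<close> therefore shows that \<open>x\<^sup>i \<otimes> d\<^sub>l\<^sup>2\<close> preserves \<open>N\<close>
  (\<open>mixed_difference_X_X\<close>). Together with \<open>X\<^sub>0 = \<partial> \<otimes> 1\<close> it follows that \<open>N\<close> is stable under \<open>a \<otimes> d\<^sub>l\<^sup>2\<close>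
  for every \<open>a\<close> in the Weyl algebra (\<open>X_stable_imp_tact_stable\<close>).

  The endomorphisms of \<open>P\<close> are scalars, by the usual argument that compares the countable dimension
  of \<open>P\<close> with the uncountable field (\<open>simple_weyl_module_schur\<close>). As \<open>d\<^sub>l\<^sup>2\<close> is injective, a
  shortest nonzero tensor in \<open>N\<close> can then only be pure, and so \<open>P \<otimes> u \<subseteq> N\<close> for some \<open>u \<noteq> 0\<close>
  (\<open>simple_weyl_module_tensor_pure\<close>). Finally, the vectors \<open>v\<close> with \<open>P \<otimes> v \<subseteq> N\<close> form a submodule of
  \<open>V\<close> (\<open>X_stable_slices_submodule\<close>), which is all of \<open>V\<close> because \<open>V\<close> is simple.
\<close>

section \<open>Differences along lines of constant total index\<close>

text \<open>
Applied to a family \<open>f\<close> of two indices, this is the \<open>n\<close>-fold iterate of the difference in the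
direction \<open>(1, -1)\<close>, which keeps the total index \<open>j + k\<close> constant. The iterate recurses on the
already differenced family, so that the rules below need no reindexing.
\<close>

primrec mixed_difference ::
    "nat \<Rightarrow> (nat \<Rightarrow> nat \<Rightarrow> 'a::ab_group_add) \<Rightarrow> nat \<Rightarrow> nat \<Rightarrow> 'a"
  where
    "mixed_difference 0 f = f"
  | "mixed_difference (Suc n) f = mixed_difference n (\<lambda>j k. f (Suc j) k - f j (Suc k))"

lemma mixed_difference_zero: "mixed_difference n (\<lambda>j k. 0) = (\<lambda>j k. 0)"
  by (induction n) auto

lemma mixed_difference_add:
  "mixed_difference n (\<lambda>j k. f j k + g j k) j k
    = mixed_difference n f j k + mixed_difference n g j k"
proof (induction n arbitrary: f g)
  case (Suc n)
  have "(\<lambda>j k. f (Suc j) k + g (Suc j) k - (f j (Suc k) + g j (Suc k)))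
      = (\<lambda>j k. (f (Suc j) k - f j (Suc k)) + (g (Suc j) k - g j (Suc k)))"
    by (simp add: algebra_simps)
  then show ?case by (simp add: Suc)
qed simp

lemma mixed_difference_minus:
  "mixed_difference n (\<lambda>j k. f j k - g j k) j k
    = mixed_difference n f j k - mixed_difference n g j k"
  using mixed_difference_add[of n "\<lambda>j k. f j k - g j k" g j k] by simp

lemma mixed_difference_sum:
  "mixed_difference n (\<lambda>j k. \<Sum>i\<in>I. f i j k) j k = (\<Sum>i\<in>I. mixed_difference n (f i) j k)"
  by (induction I rule: infinite_finite_induct)
    (simp_all add: mixed_difference_zero mixed_difference_add)

text \<open>
Vectors that depend on the total index alone pass through the difference, since all terms of
an \<open>n\<close>-fold mixed difference at \<open>(j, k)\<close> have total index \<open>j + k + n\<close>.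
\<close>

lemma mixed_difference_scaleC:
  "mixed_difference n (\<lambda>j k. h j k *\<^sub>C w (j + k)) j k = mixed_difference n h j k *\<^sub>C w (j + k + n)"
proof (induction n arbitrary: h w)
  case (Suc n)
  show ?case
    using Suc[of "\<lambda>j k. h (Suc j) k - h j (Suc k)" "\<lambda>c. w (Suc c)"]
    by (simp add: cvec.scale_left_diff_distrib)
qed simp

lemma mixed_difference_mem:
  assumes "csubspace N" "\<And>j k. f j k \<in> N"
  shows "mixed_difference n f j k \<in> N"
  using assms(2) by (induction n arbitrary: f) (simp_all add: cvec.subspace_diff[OF assms(1)])

definition binomial_product :: "nat \<Rightarrow> nat \<Rightarrow> nat \<Rightarrow> nat \<Rightarrow> complex"
  where "binomial_product \<alpha> \<beta> j k = of_nat (j choose \<alpha>) * of_nat (k choose \<beta>)"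

text \<open>
On lines of constant \<open>j + k\<close> the product of binomial coefficients is a polynomial of degree
\<open>\<alpha> + \<beta>\<close>, so differences of higher order kill it and the difference of that order is a constant.
By Pascal's rule, one difference step lowers \<open>\<alpha>\<close> by one, minus the same with \<open>\<beta>\<close>; the value
of the constant follows by Pascal's rule once more.
\<close>

lemma mixed_difference_binomial_low:
  "\<alpha> + \<beta> < n \<Longrightarrow> mixed_difference n (binomial_product \<alpha> \<beta>) = (\<lambda>j k. 0)"
  and mixed_difference_binomial_top:
  "\<alpha> + \<beta> = n \<Longrightarrow>
    mixed_difference n (binomial_product \<alpha> \<beta>) = (\<lambda>j k. (-1) ^ \<beta> * of_nat (n choose \<beta>))"
proof (induction n arbitrary: \<alpha> \<beta>)
  case (Suc n)
  have step: "mixed_difference (Suc n) (binomial_product \<alpha> \<beta>) j k =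
      (case \<alpha> of 0 \<Rightarrow> 0 | Suc a \<Rightarrow> mixed_difference n (binomial_product a \<beta>) j k) -
      (case \<beta> of 0 \<Rightarrow> 0 | Suc b \<Rightarrow> mixed_difference n (binomial_product \<alpha> b) j k)" for \<alpha> \<beta> j k
  proof -
    have "(\<lambda>j k. binomial_product \<alpha> \<beta> (Suc j) k - binomial_product \<alpha> \<beta> j (Suc k)) =
      (\<lambda>j k. (case \<alpha> of 0 \<Rightarrow> 0 | Suc a \<Rightarrow> binomial_product a \<beta> j k) -
      (case \<beta> of 0 \<Rightarrow> 0 | Suc b \<Rightarrow> binomial_product \<alpha> b j k))"
      by (cases \<alpha>; cases \<beta>) (simp_all add: fun_eq_iff binomial_product_def algebra_simps)
    then show ?thesis
      by (cases \<alpha>; cases \<beta>)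
        (simp_all only: mixed_difference.simps mixed_difference_minus mixed_difference_zero nat.case)
  qed
  {
    case 1
    then show ?case
      by (intro ext, unfold step) (cases \<alpha>; cases \<beta>; simp add: Suc.IH)
  next
    case 2
    then show ?case
      by (intro ext, unfold step) (cases \<alpha>; cases \<beta>; force simp add: Suc.IH algebra_simps)
  }
qed (simp_all add: fun_eq_iff binomial_product_def)

section \<open>Binomial sums\<close>

lemma sum_atMost_change_bound:
  assumes "\<And>i. i > k \<Longrightarrow> f i = 0" "\<And>i. i > (n::nat) \<Longrightarrow> f i = 0"
  shows "sum f {..k} = sum f {..n}"
  using assms by (intro sum.mono_neutral_cong) auto

lemma vandermonde_weighted:
  "(\<Sum>i\<le>Suc n. i * (j choose i) * (k choose (Suc n - i))) = j * ((j + k - 1) choose n)"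
proof (cases j)
  case (Suc m)
  have "(\<Sum>i\<le>Suc n. i * (j choose i) * (k choose (Suc n - i)))
      = (\<Sum>i\<le>n. Suc i * (j choose Suc i) * (k choose (n - i)))"
    by (subst sum.atMost_Suc_shift) simp
  also have "\<dots> = (\<Sum>i\<le>n. j * ((m choose i) * (k choose (n - i))))"
    by (simp only: binomial_absorption Suc mult.assoc diff_Suc_1)
  also have "\<dots> = j * ((m + k) choose n)"
    by (simp only: vandermonde flip: sum_distrib_left)
  finally show ?thesis by (simp add: Suc)
next
  case 0
  have "i * (0 choose i) = 0" for i :: nat
    by (cases i) simp_all
  then show ?thesis by (simp only: 0) simp
qed

text \<open>
The structure constants of the Witt algebra arise from this convolution.
\<close>

lemma vandermonde_skew:
  "(\<Sum>i\<le>Suc n. (of_nat (Suc n - i) - of_nat i) * binomial_product i (Suc n - i) j k)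
    = (of_nat k - of_nat j) * of_nat ((j + k - 1) choose n)"
proof -
  have flip: "(\<Sum>i\<le>Suc n. (Suc n - i) * (j choose i) * (k choose (Suc n - i))) = k * ((j + k - 1) choose n)"
    using vandermonde_weighted[where n = n and j = k and k = j]
      sum.atLeastAtMost_rev[of "\<lambda>i. i * (k choose i) * (j choose (Suc n - i))" 0 "Suc n"]
    by (simp add: atMost_atLeast0 ac_simps del: sum.cl_ivl_Suc)
  have "(\<Sum>i\<le>Suc n. (of_nat (Suc n - i) - of_nat i) * binomial_product i (Suc n - i) j k)
    = of_nat (\<Sum>i\<le>Suc n. (Suc n - i) * (j choose i) * (k choose (Suc n - i)))
      - of_nat (\<Sum>i\<le>Suc n. i * (j choose i) * (k choose (Suc n - i)))"
    by (simp only: of_nat_sum sum_subtractf[symmetric] of_nat_mult binomial_product_def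
        left_diff_distrib mult.assoc)
  then show ?thesis
    by (simp only: flip vandermonde_weighted of_nat_mult left_diff_distrib)
qed

section \<open>Witt operators in an abstract realization\<close>

text \<open>
The commutation pattern of \<open>M = x \<otimes> 1\<close>, \<open>e\<^sub>0 = \<partial> \<otimes> 1\<close> and \<open>e\<^sub>r\<^sub>+\<^sub>1 = 1 \<otimes> d\<^sub>r\<close> on \<open>P \<otimes> V\<close>.
Treating \<open>\<partial>\<close> as the operator of index 0 makes the formula for \<open>\<phi>(d\<^sub>k\<^sub>-\<^sub>1)\<close>, which is \<open>X k\<close> below,
uniform in \<open>k \<ge> 0\<close>: its first term is \<open>x\<^sup>k\<partial>\<close>, also for \<open>k = 0\<close>.
\<close>

locale witt_realization =
  fixes M :: "'t::complex_vector \<Rightarrow> 't" and e :: "nat \<Rightarrow> 't \<Rightarrow> 't"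
  assumes clinear_M: "clinear M" and clinear_e: "\<And>r. clinear (e r)"
    and e_0_M: "\<And>t. e 0 (M t) = M (e 0 t) + t"
    and e_Suc_M: "\<And>r t. e (Suc r) (M t) = M (e (Suc r) t)"
begin

sublocale M: Vector_Spaces.linear scaleC scaleC M by (fact clinear_M)
sublocale e: Vector_Spaces.linear scaleC scaleC "e r" for r by (fact clinear_e)

lemma clinear_M_power: "clinear (M ^^ n)"
proof (rule clinearI)
  show "(M ^^ n) (s + t) = (M ^^ n) s + (M ^^ n) t" for s t
    by (induction n) (simp_all add: M.add)
  show "(M ^^ n) (c *\<^sub>C t) = c *\<^sub>C (M ^^ n) t" for c t
    by (induction n) (simp_all add: M.scale)
qed

sublocale Mn: Vector_Spaces.linear scaleC scaleC "M ^^ n" for n by (fact clinear_M_power)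

definition X :: "nat \<Rightarrow> 't \<Rightarrow> 't"
  where "X k t = (\<Sum>r\<le>k. of_nat (k choose r) *\<^sub>C (M ^^ (k - r)) (e r t))"

lemma clinear_X: "clinear (X k)"
  by (rule clinearI)
    (simp_all add: X_def e.add e.scale Mn.add Mn.scale scaleC_add_right sum.distrib
      cvec.scale_sum_right scaleC_scaleC mult.commute)

lemma e_M_power:
  "e r ((M ^^ m) t) =
    (M ^^ m) (e r t) + (if r = 0 then of_nat m *\<^sub>C (M ^^ (m - 1)) t else 0)"
proof (induction m)
  case (Suc m)
  show ?case
  proof (cases r)
    case 0
    have "e 0 ((M ^^ Suc m) t) = M ((M ^^ m) (e 0 t) + of_nat m *\<^sub>C (M ^^ (m - 1)) t) + (M ^^ m) t"
      using Suc by (simp add: e_0_M 0)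
    also have "M (of_nat m *\<^sub>C (M ^^ (m - 1)) t) = of_nat m *\<^sub>C (M ^^ m) t"
      by (cases m) (simp_all add: M.scale)
    then have "M ((M ^^ m) (e 0 t) + of_nat m *\<^sub>C (M ^^ (m - 1)) t) + (M ^^ m) t
       = (M ^^ Suc m) (e 0 t) + of_nat (Suc m) *\<^sub>C (M ^^ m) t"
      by (simp add: M.add scaleC_add_left scaleC_one algebra_simps)
    finally show ?thesis by (simp add: 0)
  qed (use Suc in \<open>simp_all add: e_Suc_M\<close>)
qed simp

text \<open>
Normal ordering of a product: all powers of \<open>M\<close> are moved to the left. The only correction comes
from \<open>e\<^sub>0\<close> in the left factor, and it contains a single \<open>e\<^sub>\<beta>\<close>. Besides the binomial
coefficients, the summands depend on \<open>j\<close> and \<open>k\<close> only through \<open>j + k\<close>.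
\<close>

lemma X_X:
  "X j (X k t) =
    (\<Sum>\<alpha>\<le>j. \<Sum>\<beta>\<le>k. binomial_product \<alpha> \<beta> j k *\<^sub>C (M ^^ (j + k - (\<alpha> + \<beta>))) (e \<alpha> (e \<beta> t))) +
    (\<Sum>\<beta>\<le>k. (of_nat (Suc \<beta>) * of_nat (k choose Suc \<beta>)) *\<^sub>C (M ^^ (j + k - Suc \<beta>)) (e \<beta> t))"
proof -
  have summand: "of_nat (j choose \<alpha>) *\<^sub>C (M ^^ (j - \<alpha>)) (e \<alpha> (of_nat (k choose \<beta>) *\<^sub>C (M ^^ (k - \<beta>)) (e \<beta> t)))
    = binomial_product \<alpha> \<beta> j k *\<^sub>C (M ^^ (j + k - (\<alpha> + \<beta>))) (e \<alpha> (e \<beta> t)) +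
      (if \<alpha> = 0 then (of_nat (Suc \<beta>) * of_nat (k choose Suc \<beta>)) *\<^sub>C (M ^^ (j + k - Suc \<beta>)) (e \<beta> t)
       else 0)" if "\<alpha> \<le> j" "\<beta> \<le> k" for \<alpha> \<beta>
  proof -
    have pow: "(M ^^ (j - \<alpha>)) ((M ^^ (k - \<beta>)) s) = (M ^^ (j + k - (\<alpha> + \<beta>))) s" for s
      using that by (simp flip: funpow_add[THEN fun_cong, unfolded comp_def])
    have coef: "(k choose \<beta>) * (k - \<beta>) = Suc \<beta> * (k choose Suc \<beta>)"
      using binomial_absorb_comp[of k \<beta>] binomial_absorption[of \<beta> k] by (simp add: mult.commute)
    have coef': "of_nat (k choose \<beta>) * of_nat (k - \<beta>) = (of_nat (Suc \<beta>) * of_nat (k choose Suc \<beta>) :: complex)"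
      using coef by (metis of_nat_mult)
    have low: "of_nat (k choose \<beta>) *\<^sub>C of_nat (k - \<beta>) *\<^sub>C (M ^^ j) ((M ^^ (k - \<beta> - 1)) (e \<beta> t)) =
      (of_nat (Suc \<beta>) * of_nat (k choose Suc \<beta>)) *\<^sub>C (M ^^ (j + k - Suc \<beta>)) (e \<beta> t)"
    proof (cases "\<beta> = k")
      case False
      then have "j + k - Suc \<beta> = j + (k - \<beta> - 1)" using that by simp
      then show ?thesis by (simp only: scaleC_scaleC coef' funpow_add comp_def)
    qed simp
    show ?thesis
    proof (cases "\<alpha> = 0")
      case True
      then show ?thesis using low pow
        by (simp add: e.scale Mn.scale e_M_power Mn.add scaleC_add_right scaleC_one binomial_product_def)
    next
      case False
      then show ?thesis using pow by (simp add: e.scale Mn.scale e_M_power scaleC_scaleC binomial_product_def)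
    qed
  qed
  have "X j (X k t) = (\<Sum>\<alpha>\<le>j. \<Sum>\<beta>\<le>k. of_nat (j choose \<alpha>) *\<^sub>C (M ^^ (j - \<alpha>)) (e \<alpha> (of_nat (k choose \<beta>) *\<^sub>C (M ^^ (k - \<beta>)) (e \<beta> t))))"
    by (simp add: X_def e.sum Mn.sum cvec.scale_sum_right)
  also have "\<dots> = (\<Sum>\<alpha>\<le>j. \<Sum>\<beta>\<le>k. binomial_product \<alpha> \<beta> j k *\<^sub>C (M ^^ (j + k - (\<alpha> + \<beta>))) (e \<alpha> (e \<beta> t)) +
      (if \<alpha> = 0 then (of_nat (Suc \<beta>) * of_nat (k choose Suc \<beta>)) *\<^sub>C (M ^^ (j + k - Suc \<beta>)) (e \<beta> t)
       else 0))"
    by (intro sum.cong refl summand) auto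
  also have "\<dots> = (\<Sum>\<alpha>\<le>j. \<Sum>\<beta>\<le>k. binomial_product \<alpha> \<beta> j k *\<^sub>C (M ^^ (j + k - (\<alpha> + \<beta>))) (e \<alpha> (e \<beta> t))) +
      (\<Sum>\<beta>\<le>k. \<Sum>\<alpha>\<le>j. (if \<alpha> = 0 then (of_nat (Suc \<beta>) * of_nat (k choose Suc \<beta>)) *\<^sub>C (M ^^ (j + k - Suc \<beta>)) (e \<beta> t)
       else 0))"
    by (simp only: sum.distrib) (subst (2) sum.swap, rule refl)
  finally show ?thesis by simp
qed

text \<open>
In the antisymmetrisation of \<open>X_X\<close>, the corrections from \<open>e\<^sub>0\<close> are exactly the terms that would
come from the bracket rule \<open>[e\<^sub>\<alpha>, e\<^sub>\<beta>] = (\<beta> - \<alpha>) e\<^sub>\<alpha>\<^sub>+\<^sub>\<beta>\<^sub>-\<^sub>1\<close> if it also held for \<open>\<alpha> = 0\<close> or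
\<open>\<beta> = 0\<close>. Hence the commutator is one full convolution over all \<open>\<alpha>, \<beta>\<close>, which
\<open>vandermonde_skew\<close> evaluates.
\<close>

lemma X_commutator:
  assumes e_0: "\<And>s t. e 0 (e s t) = e s (e 0 t)"
    and e_Suc: "\<And>r s t. e (Suc r) (e (Suc s) t) - e (Suc s) (e (Suc r) t)
      = (of_nat s - of_nat r) *\<^sub>C e (Suc (r + s)) t"
  shows "X j (X k t) - X k (X j t) = (of_nat k - of_nat j) *\<^sub>C X (j + k - 1) t"
proof -
  define w where "w \<gamma> = (M ^^ (j + k - \<gamma>)) (e (\<gamma> - 1) t)" for \<gamma>
  define E where "E \<alpha> \<beta> = (M ^^ (j + k - (\<alpha> + \<beta>))) (e \<alpha> (e \<beta> t))" for \<alpha> \<beta>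
  let ?g = "\<lambda>\<alpha> \<beta>. ((of_nat \<beta> - of_nat \<alpha>) * binomial_product \<alpha> \<beta> j k) *\<^sub>C w (\<alpha> + \<beta>)"
  let ?h = "\<lambda>k \<beta>. (of_nat \<beta> * of_nat (k choose \<beta>)) *\<^sub>C w \<beta>"
  have E: "binomial_product \<alpha> \<beta> j k *\<^sub>C (E \<alpha> \<beta> - E \<beta> \<alpha>) =
      ?g \<alpha> \<beta> - (if \<alpha> = 0 then ?h k \<beta> else 0) + (if \<beta> = 0 then ?h j \<alpha> else 0)" for \<alpha> \<beta>
  proof -
    have "e \<alpha> (e \<beta> t) - e \<beta> (e \<alpha> t) =
        (if \<alpha> = 0 \<or> \<beta> = 0 then 0 else (of_nat \<beta> - of_nat \<alpha>) *\<^sub>C e (\<alpha> + \<beta> - 1) t)"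
      using e_0[of \<beta> t] e_0[of \<alpha> t] e_Suc[of "\<alpha> - 1" "\<beta> - 1" t]
      by (cases \<alpha>; cases \<beta>) simp_all
    moreover have "E \<alpha> \<beta> - E \<beta> \<alpha> = (M ^^ (j + k - (\<alpha> + \<beta>))) (e \<alpha> (e \<beta> t) - e \<beta> (e \<alpha> t))"
      by (simp add: E_def Mn.diff add.commute)
    ultimately have "E \<alpha> \<beta> - E \<beta> \<alpha> =
        (if \<alpha> = 0 \<or> \<beta> = 0 then 0 else (of_nat \<beta> - of_nat \<alpha>) *\<^sub>C w (\<alpha> + \<beta>))"
      by (simp add: w_def Mn.scale Mn.zero del: cvec.scale_left_diff_distrib)
    then show ?thesis
      by (auto simp: binomial_product_def scaleC_scaleC mult.commute
          simp del: cvec.scale_left_diff_distrib)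
  qed
  have tail: "(\<Sum>\<beta>\<le>n. (of_nat (Suc \<beta>) * of_nat (n choose Suc \<beta>)) *\<^sub>C (M ^^ (j' + k' - Suc \<beta>)) (e \<beta> t))
      = (\<Sum>\<beta>\<le>n. ?h n \<beta>)" if "j' + k' = j + k" for j' k' n
  proof -
    have "(\<Sum>\<beta>\<le>Suc n. ?h n \<beta>) = (\<Sum>\<beta>\<le>n. ?h n (Suc \<beta>))"
      by (subst sum.atMost_Suc_shift) simp
    then show ?thesis using that by (simp add: w_def binomial_eq_0)
  qed
  have "X j (X k t) - X k (X j t) =
      (\<Sum>\<alpha>\<le>j. \<Sum>\<beta>\<le>k. binomial_product \<alpha> \<beta> j k *\<^sub>C E \<alpha> \<beta>) + (\<Sum>\<beta>\<le>k. ?h k \<beta>)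
      - ((\<Sum>\<beta>\<le>k. \<Sum>\<alpha>\<le>j. binomial_product \<alpha> \<beta> j k *\<^sub>C E \<beta> \<alpha>) + (\<Sum>\<alpha>\<le>j. ?h j \<alpha>))"
    unfolding X_X tail[OF refl] tail[OF add.commute]
    by (simp add: E_def binomial_product_def mult.commute add.commute)
  also have "\<dots> = (\<Sum>\<alpha>\<le>j. \<Sum>\<beta>\<le>k. binomial_product \<alpha> \<beta> j k *\<^sub>C (E \<alpha> \<beta> - E \<beta> \<alpha>))
      + (\<Sum>\<beta>\<le>k. ?h k \<beta>) - (\<Sum>\<alpha>\<le>j. ?h j \<alpha>)"
  proof -
    have "(\<Sum>\<beta>\<le>k. \<Sum>\<alpha>\<le>j. binomial_product \<alpha> \<beta> j k *\<^sub>C E \<beta> \<alpha>)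
        = (\<Sum>\<alpha>\<le>j. \<Sum>\<beta>\<le>k. binomial_product \<alpha> \<beta> j k *\<^sub>C E \<beta> \<alpha>)"
      by (rule sum.swap)
    then show ?thesis by (simp add: cvec.scale_right_diff_distrib sum_subtractf)
  qed
  also have "\<dots> = (\<Sum>\<alpha>\<le>j. \<Sum>\<beta>\<le>k. ?g \<alpha> \<beta>)"
  proof -
    have "(\<Sum>\<alpha>\<le>j. \<Sum>\<beta>\<le>k. if \<alpha> = 0 then ?h k \<beta> else 0) = (\<Sum>\<beta>\<le>k. ?h k \<beta>)"
      by (subst sum.swap) simp
    moreover have "(\<Sum>\<alpha>\<le>j. \<Sum>\<beta>\<le>k. if \<beta> = 0 then ?h j \<alpha> else 0) = (\<Sum>\<alpha>\<le>j. ?h j \<alpha>)"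
      by simp
    ultimately show ?thesis
      by (simp only: E sum.distrib sum_subtractf) simp
  qed
  also have "\<dots> = (\<Sum>(\<alpha>, \<beta>)\<in>{..j} \<times> {..k}. ?g \<alpha> \<beta>)"
    by (simp add: sum.cartesian_product)
  also have "\<dots> = (\<Sum>(\<alpha>, \<beta>)\<in>{(\<alpha>, \<beta>). \<alpha> + \<beta> \<le> j + k}. ?g \<alpha> \<beta>)"
  proof (rule sum.mono_neutral_left)
    have "{(\<alpha>, \<beta>). \<alpha> + \<beta> \<le> j + k} \<subseteq> {..j + k} \<times> {..j + k}" by auto
    then show "finite {(\<alpha>, \<beta>). \<alpha> + \<beta> \<le> j + k}"
      by (rule finite_subset) simp
  qed (auto simp: binomial_product_def not_le)
  also have "\<dots> = (\<Sum>\<gamma>\<le>j + k. \<Sum>\<alpha>\<le>\<gamma>. ?g \<alpha> (\<gamma> - \<alpha>))"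
    by (rule sum.triangle_reindex_eq)
  also have "\<dots> = (\<Sum>\<gamma>\<le>j + k. (\<Sum>\<alpha>\<le>\<gamma>. (of_nat (\<gamma> - \<alpha>) - of_nat \<alpha>) * binomial_product \<alpha> (\<gamma> - \<alpha>) j k) *\<^sub>C w \<gamma>)"
    by (simp add: cvec.scale_sum_left)
  also have "\<dots> = (of_nat k - of_nat j) *\<^sub>C X (j + k - 1) t"
  proof (cases "j + k")
    case (Suc n)
    have "(\<Sum>\<gamma>\<le>Suc n. (\<Sum>\<alpha>\<le>\<gamma>. (of_nat (\<gamma> - \<alpha>) - of_nat \<alpha>) * binomial_product \<alpha> (\<gamma> - \<alpha>) j k) *\<^sub>C w \<gamma>)
      = (\<Sum>\<gamma>\<le>n. ((of_nat k - of_nat j) * of_nat ((j + k - 1) choose \<gamma>)) *\<^sub>C w (Suc \<gamma>))"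
      by (subst sum.atMost_Suc_shift) (simp only: vandermonde_skew, simp)
    then show ?thesis
      by (simp add: Suc X_def w_def cvec.scale_sum_right scaleC_scaleC)
  qed simp
  finally show ?thesis .
qed

text \<open>
When only finitely many \<open>e\<^sub>r\<close> are nonzero, the summation range can be made independent of \<open>j\<close> and
\<open>k\<close>, as mixed differences require.
\<close>

lemma X_X_uniform:
  assumes vanish: "\<And>r t. r > R \<Longrightarrow> e r t = 0"
  shows "X j (X k t) =
    (\<Sum>\<alpha>\<le>R. \<Sum>\<beta>\<le>R. binomial_product \<alpha> \<beta> j k *\<^sub>C (M ^^ (j + k - (\<alpha> + \<beta>))) (e \<alpha> (e \<beta> t))) +
    (\<Sum>\<beta>\<le>R. binomial_product 0 (Suc \<beta>) j k *\<^sub>C of_nat (Suc \<beta>) *\<^sub>C (M ^^ (j + k - Suc \<beta>)) (e \<beta> t))"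
proof -
  have "(\<Sum>\<beta>\<le>k. binomial_product \<alpha> \<beta> j k *\<^sub>C (M ^^ (j + k - (\<alpha> + \<beta>))) (e \<alpha> (e \<beta> t)))
     = (\<Sum>\<beta>\<le>R. binomial_product \<alpha> \<beta> j k *\<^sub>C (M ^^ (j + k - (\<alpha> + \<beta>))) (e \<alpha> (e \<beta> t)))" for \<alpha>
    by (rule sum_atMost_change_bound) (simp_all add: binomial_product_def vanish e.zero Mn.zero)
  moreover have "(\<Sum>\<alpha>\<le>j. \<Sum>\<beta>\<le>R. binomial_product \<alpha> \<beta> j k *\<^sub>C (M ^^ (j + k - (\<alpha> + \<beta>))) (e \<alpha> (e \<beta> t)))
     = (\<Sum>\<alpha>\<le>R. \<Sum>\<beta>\<le>R. binomial_product \<alpha> \<beta> j k *\<^sub>C (M ^^ (j + k - (\<alpha> + \<beta>))) (e \<alpha> (e \<beta> t)))"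
    by (rule sum_atMost_change_bound) (simp_all add: binomial_product_def binomial_eq_0 vanish Mn.zero)
  moreover have "(\<Sum>\<beta>\<le>k. (of_nat (Suc \<beta>) * of_nat (k choose Suc \<beta>)) *\<^sub>C (M ^^ (j + k - Suc \<beta>)) (e \<beta> t))
     = (\<Sum>\<beta>\<le>R. (of_nat (Suc \<beta>) * of_nat (k choose Suc \<beta>)) *\<^sub>C (M ^^ (j + k - Suc \<beta>)) (e \<beta> t))"
    by (rule sum_atMost_change_bound) (simp_all add: vanish Mn.zero)
  ultimately show ?thesis
    by (simp add: X_X binomial_product_def scaleC_scaleC mult.commute)
qed

text \<open>
Among the coefficients in \<open>X_X_uniform\<close> only the one at \<open>\<alpha> = \<beta> = R\<close> has degree \<open>2 R\<close>: the
correction terms have degree at most \<open>R + 1\<close>, which is smaller because \<open>R > 1\<close>. A mixed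
difference of order \<open>2 R\<close> therefore isolates the square of the top operator.
\<close>

lemma mixed_difference_X_X:
  assumes vanish: "\<And>r t. r > R \<Longrightarrow> e r t = 0" and "R > 1"
  shows "mixed_difference (2 * R) (\<lambda>j k. X j (X k t)) m 0
    = ((-1) ^ R * of_nat ((2 * R) choose R)) *\<^sub>C (M ^^ m) (e R (e R t))"
proof -
  have diff: "mixed_difference (2 * R) (binomial_product \<alpha> \<beta>) m 0 =
      (if \<alpha> = R \<and> \<beta> = R then (-1) ^ R * of_nat ((2 * R) choose R) else 0)"
    if "\<alpha> \<le> R" "\<beta> \<le> R" for \<alpha> \<beta>
  proof (cases "\<alpha> = R \<and> \<beta> = R")
    case True
    then show ?thesis by (simp add: mixed_difference_binomial_top)
  next
    case False
    then have "\<alpha> + \<beta> < 2 * R" using that by auto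
    then show ?thesis using False by (simp add: mixed_difference_binomial_low)
  qed
  have tail: "mixed_difference (2 * R) (binomial_product 0 (Suc \<beta>)) m 0 = 0" if "\<beta> \<le> R" for \<beta>
    using that \<open>R > 1\<close> by (simp add: mixed_difference_binomial_low)
  have "mixed_difference (2 * R) (\<lambda>j k. X j (X k t)) m 0 =
    mixed_difference (2 * R) (\<lambda>j k.
     (\<Sum>\<alpha>\<le>R. \<Sum>\<beta>\<le>R. binomial_product \<alpha> \<beta> j k *\<^sub>C (M ^^ (j + k - (\<alpha> + \<beta>))) (e \<alpha> (e \<beta> t))) +
     (\<Sum>\<beta>\<le>R. binomial_product 0 (Suc \<beta>) j k *\<^sub>C of_nat (Suc \<beta>) *\<^sub>C (M ^^ (j + k - Suc \<beta>)) (e \<beta> t))) m 0"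
    by (simp only: X_X_uniform[of R, OF vanish])
  also have "\<dots> =
     (\<Sum>\<alpha>\<le>R. \<Sum>\<beta>\<le>R. mixed_difference (2 * R) (binomial_product \<alpha> \<beta>) m 0 *\<^sub>C
        (M ^^ (m + 0 + 2 * R - (\<alpha> + \<beta>))) (e \<alpha> (e \<beta> t))) +
     (\<Sum>\<beta>\<le>R. mixed_difference (2 * R) (binomial_product 0 (Suc \<beta>)) m 0 *\<^sub>C
        of_nat (Suc \<beta>) *\<^sub>C (M ^^ (m + 0 + 2 * R - Suc \<beta>)) (e \<beta> t))"
    by (simp only: mixed_difference_add mixed_difference_sum
       mixed_difference_scaleC[where w = "\<lambda>c. (M ^^ (c - (\<alpha> + \<beta>))) (e \<alpha> (e \<beta> t))" for \<alpha> \<beta>]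
       mixed_difference_scaleC[where w = "\<lambda>c. of_nat (Suc \<beta>) *\<^sub>C (M ^^ (c - Suc \<beta>)) (e \<beta> t)" for \<beta>])
  also have "(\<Sum>\<beta>\<le>R. mixed_difference (2 * R) (binomial_product 0 (Suc \<beta>)) m 0 *\<^sub>C
        of_nat (Suc \<beta>) *\<^sub>C (M ^^ (m + 0 + 2 * R - Suc \<beta>)) (e \<beta> t)) = 0"
    by (simp add: tail)
  also have "(\<Sum>\<alpha>\<le>R. \<Sum>\<beta>\<le>R. mixed_difference (2 * R) (binomial_product \<alpha> \<beta>) m 0 *\<^sub>C
        (M ^^ (m + 0 + 2 * R - (\<alpha> + \<beta>))) (e \<alpha> (e \<beta> t))) = (\<Sum>\<alpha>\<le>R. \<Sum>\<beta>\<le>R. if \<beta> = R then if \<alpha> = R then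
      ((-1) ^ R * of_nat ((2 * R) choose R)) *\<^sub>C (M ^^ m) (e R (e R t)) else 0 else 0)"
    by (intro sum.cong refl) (auto simp: diff)
  finally show ?thesis by simp
qed

end

section \<open>Tensor products\<close>

global_interpretation pure_left: Vector_Spaces.linear scaleC scaleC "\<lambda>x. x \<otimes>\<^sub>C y" for y
  using cbilinear_pure_tensor by (auto simp: cbilinear_def)

global_interpretation pure_right: Vector_Spaces.linear scaleC scaleC "\<lambda>y. x \<otimes>\<^sub>C y" for x
  using cbilinear_pure_tensor by (auto simp: cbilinear_def)

lemma tensor_induct [case_names pure scale add]:
  assumes pure: "\<And>x y. Q (x \<otimes>\<^sub>C y)"
    and scale: "\<And>c t. Q t \<Longrightarrow> Q (c *\<^sub>C t)"
    and add: "\<And>s t. Q s \<Longrightarrow> Q t \<Longrightarrow> Q (s + t)"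
  shows "Q t"
proof (induction t)
  case (1 f)
  show ?case
  proof (induction f rule: update_induct)
    case const
    have "Q (0 \<otimes>\<^sub>C 0)" by (rule pure)
    then show ?case by (simp add: pure_left.zero flip: zero_tensor.abs_eq)
  next
    case (update f a b)
    have "Poly_Mapping.update a b f = f + b *\<^sub>C Poly_Mapping.single a 1"
      using update(1) by (intro poly_mapping_eqI)
        (auto simp: lookup_update lookup_add lookup_single when_def in_keys_iff scaleC_complex_def)
    then have "abs_tensor (Poly_Mapping.update a b f) = abs_tensor f + b *\<^sub>C (fst a \<otimes>\<^sub>C snd a)"
      by (simp add: pure_tensor.abs_eq plus_tensor.abs_eq scaleC_tensor.abs_eq)
    then show ?case by (simp add: add scale pure update)
  qed
qed

lemma clinear_eq_on_pure:
  assumes "clinear f" "clinear g" "\<And>x y. f (x \<otimes>\<^sub>C y) = g (x \<otimes>\<^sub>C y)"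
  shows "f t = g t"
proof -
  interpret f: Vector_Spaces.linear scaleC scaleC f by fact
  interpret g: Vector_Spaces.linear scaleC scaleC g by fact
  show ?thesis
    by (induction t rule: tensor_induct) (simp_all add: assms(3) f.add g.add f.scale g.scale)
qed

lemma clinear_ident: "clinear (\<lambda>x. x)"
  by (rule clinearI) simp_all

lemma clinear_compose:
  assumes "clinear f" "clinear g"
  shows "clinear (\<lambda>t. g (f t))"
  using Vector_Spaces.linear_compose[OF assms] by (simp add: comp_def)

lemma tensor_map_tensor_map:
  assumes "clinear f" "clinear g" "clinear f'" "clinear g'"
  shows "tensor_map f' g' (tensor_map f g t) = tensor_map (\<lambda>x. f' (f x)) (\<lambda>y. g' (g y)) t"
proof (rule clinear_eq_on_pure[where t = t])
  show "clinear (\<lambda>t. tensor_map f' g' (tensor_map f g t))"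
    by (rule clinear_compose) (rule clinear_tensor_map; fact)+
  show "clinear (tensor_map (\<lambda>x. f' (f x)) (\<lambda>y. g' (g y)))"
    by (rule clinear_tensor_map; rule clinear_compose; fact)
qed (simp add: tensor_map_pure assms clinear_compose[OF assms(1,3)] clinear_compose[OF assms(2,4)])

lemma tensor_map_id: "tensor_map (\<lambda>x. x) (\<lambda>y. y) t = t"
  by (rule clinear_eq_on_pure[OF clinear_tensor_map[OF clinear_ident clinear_ident] clinear_ident])
    (simp add: tensor_map_pure[OF clinear_ident clinear_ident])

lemma tensor_expansion:
  fixes t :: "('a::complex_vector, 'b::complex_vector) tensor"
  obtains S f where "finite S" "cvec.independent S" "t = (\<Sum>v\<in>S. f v \<otimes>\<^sub>C v)"
proof -
  define B where "B = (cvec.extend_basis {} :: 'b set)"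
  have B: "cvec.independent B" "cspan B = UNIV"
    unfolding B_def
    by (rule cvec.independent_extend_basis[OF cvec.independent_empty])
      (rule cvec.span_extend_basis[OF cvec.independent_empty])
  have "\<exists>S f. finite S \<and> S \<subseteq> B \<and> t = (\<Sum>v\<in>S. f v \<otimes>\<^sub>C v)"
  proof (induction t rule: tensor_induct)
    case (pure x y)
    have "y = (\<Sum>v | cvec.representation B y v \<noteq> 0. cvec.representation B y v *\<^sub>C v)"
      using cvec.sum_nonzero_representation_eq[of B y] B by simp
    then have "x \<otimes>\<^sub>C y = (\<Sum>v | cvec.representation B y v \<noteq> 0. (cvec.representation B y v *\<^sub>C x) \<otimes>\<^sub>C v)"
      by (metis (mono_tags, lifting) pure_left.scale pure_right.scale pure_right.sum sum.cong)
    then show ?case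
      using cvec.finite_representation[of B y] cvec.representation_ne_zero[of B y]
      by (intro exI conjI) auto
  next
    case (scale c t)
    then obtain S f where "finite S" "S \<subseteq> B" "t = (\<Sum>v\<in>S. f v \<otimes>\<^sub>C v)" by blast
    then have "finite S \<and> S \<subseteq> B \<and> c *\<^sub>C t = (\<Sum>v\<in>S. (c *\<^sub>C f v) \<otimes>\<^sub>C v)"
      by (simp add: cvec.scale_sum_right pure_left.scale)
    then show ?case by (intro exI)
  next
    case (add s t)
    from add(1) obtain S f where s: "finite S" "S \<subseteq> B" "s = (\<Sum>v\<in>S. f v \<otimes>\<^sub>C v)" by blast
    from add(2) obtain S' f' where t: "finite S'" "S' \<subseteq> B" "t = (\<Sum>v\<in>S'. f' v \<otimes>\<^sub>C v)" by blast
    define g where "g v = (if v \<in> S then f v else 0)" for v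
    define g' where "g' v = (if v \<in> S' then f' v else 0)" for v
    have "s = (\<Sum>v\<in>S \<union> S'. g v \<otimes>\<^sub>C v)" "t = (\<Sum>v\<in>S \<union> S'. g' v \<otimes>\<^sub>C v)"
      unfolding s(3) t(3) using s(1) t(1)
      by (auto intro!: sum.mono_neutral_cong_left simp: g_def g'_def pure_left.zero)
    then have "s + t = (\<Sum>v\<in>S \<union> S'. (g v + g' v) \<otimes>\<^sub>C v)"
      by (simp add: pure_left.add sum.distrib)
    moreover have "finite (S \<union> S')" "S \<union> S' \<subseteq> B" using s t by auto
    ultimately show ?case by (intro exI conjI)
  qed
  then show thesis using that B(1) cvec.independent_mono by blast
qed

text \<open>
The coordinate functional of \<open>u\<close>, for a basis that extends \<open>S\<close>, induces a linear map on the tensor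
product that reads off \<open>f u\<close>.
\<close>

lemma tensor_sum_eq_0D:
  fixes S :: "'b::complex_vector set" and f :: "'b \<Rightarrow> 'a::complex_vector"
  assumes S: "cvec.independent S" "finite S" and sum: "(\<Sum>v\<in>S. f v \<otimes>\<^sub>C v) = 0" and "u \<in> S"
  shows "f u = 0"
proof -
  define B where "B = cvec.extend_basis S"
  have B: "cvec.independent B" "cspan B = UNIV" "S \<subseteq> B"
    unfolding B_def using cvec.independent_extend_basis[OF S(1)] cvec.span_extend_basis[OF S(1)]
      cvec.extend_basis_superset[OF S(1)] by auto
  define b where "b = (\<lambda>(x::'a) y. cvec.representation B y u *\<^sub>C x)"
  have b: "cbilinear b"
    unfolding cbilinear_def b_def
    by (intro conjI allI clinearI)
      (simp_all add: B cvec.representation_add cvec.representation_scale scaleC_add_right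
        scaleC_add_left scaleC_scaleC mult.commute)
  interpret L: Vector_Spaces.linear scaleC scaleC "tensor_lift b"
    by (rule clinear_tensor_lift[OF b])
  have "0 = tensor_lift b (\<Sum>v\<in>S. f v \<otimes>\<^sub>C v)" by (simp add: sum L.zero)
  also have "\<dots> = (\<Sum>v\<in>S. (if v = u then f v else 0))"
    unfolding L.sum tensor_lift_pure[OF b] unfolding b_def
    by (intro sum.cong refl) (use B in \<open>auto simp: cvec.representation_basis scaleC_one subset_iff\<close>)
  also have "\<dots> = f u" using S(2) \<open>u \<in> S\<close> by simp
  finally show ?thesis by simp
qed

lemma pure_tensor_eq_0D: "x \<otimes>\<^sub>C y = 0 \<Longrightarrow> y \<noteq> 0 \<Longrightarrow> x = 0"
  using tensor_sum_eq_0D[of "{y}" "\<lambda>_. x" y] by simp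

section \<open>Simple modules over the Weyl algebra\<close>

lemma weyl_mult_scaleC: "(c *\<^sub>C a) * b = c *\<^sub>C (a * b)" for a b :: weyl
  by transfer (simp add: weyl_scaleC_mult_left congruent_mod_refl)

lemma weyl_induct [case_names one x del scale add]:
  assumes one: "Q 1"
    and x: "\<And>a. Q a \<Longrightarrow> Q (weyl_x * a)" and del: "\<And>a. Q a \<Longrightarrow> Q (weyl_del * a)"
    and scale: "\<And>c a. Q a \<Longrightarrow> Q (c *\<^sub>C a)" and add: "\<And>a b. Q a \<Longrightarrow> Q b \<Longrightarrow> Q (a + b)"
  shows "Q a"
proof (induction a)
  case (1 f)
  have word: "Q (abs_weyl (Poly_Mapping.single (Word gs) 1))" for gs
  proof (induction gs)
    case Nil
    then show ?case using one by (simp add: one_weyl.abs_eq single_one flip: zero_weyl_word_def)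
  next
    case (Cons g gs)
    have "Poly_Mapping.single (Word (g # gs)) (1::complex) = free_gen g * Poly_Mapping.single (Word gs) 1"
      by (simp add: free_gen_def mult_single plus_weyl_word_def)
    then show ?case using x[OF Cons] del[OF Cons]
      by (cases g) (simp_all add: weyl_x.abs_eq weyl_del.abs_eq times_weyl.abs_eq)
  qed
  show ?case
  proof (induction f rule: update_induct)
    case const
    have "Q (0 *\<^sub>C 1)" by (intro scale one)
    then show ?case by (simp flip: zero_weyl.abs_eq)
  next
    case (update f a b)
    have "Poly_Mapping.update a b f = f + b *\<^sub>C Poly_Mapping.single a 1"
      using update(1) by (intro poly_mapping_eqI)
        (auto simp: lookup_update lookup_add lookup_single when_def in_keys_iff scaleC_complex_def)
    then have "abs_weyl (Poly_Mapping.update a b f) = abs_weyl f + b *\<^sub>C abs_weyl (Poly_Mapping.single a 1)"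
      by (simp add: plus_weyl.abs_eq scaleC_weyl.abs_eq)
    then show ?case using word[of "letters a"] by (simp add: add scale update)
  qed
qed

lemma weyl_del_x_power:
  "weyl_del * weyl_x ^ m = weyl_x ^ m * weyl_del + of_nat m *\<^sub>C weyl_x ^ (m - 1)"
proof (induction m)
  case (Suc m)
  have "weyl_del * weyl_x ^ Suc m = (weyl_x * weyl_del + 1) * weyl_x ^ m"
    using weyl_relation by (simp add: mult.assoc[symmetric] diff_eq_eq add.commute)
  also have "\<dots> = weyl_x * (weyl_del * weyl_x ^ m) + weyl_x ^ m"
    by (simp add: distrib_right mult.assoc)
  also have "\<dots> = weyl_x ^ Suc m * weyl_del + (weyl_x * (of_nat m *\<^sub>C weyl_x ^ (m - 1)) + weyl_x ^ m)"
    by (simp add: Suc distrib_left mult.assoc)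
  also have "weyl_x * (of_nat m *\<^sub>C weyl_x ^ (m - 1)) = of_nat m *\<^sub>C weyl_x ^ m"
  proof (cases m)
    case (Suc n)
    have "weyl_x * (c *\<^sub>C a) = c *\<^sub>C (weyl_x * a)" for c a
      by transfer (simp add: weyl_scaleC_mult_right congruent_mod_refl)
    then show ?thesis by (simp add: Suc)
  qed (use weyl_mult_scaleC[of 0] in simp)
  finally show ?case by (simp add: scaleC_add_left scaleC_one add.commute)
qed simp

locale weyl_representation =
  fixes act :: "weyl \<Rightarrow> 'p::complex_vector \<Rightarrow> 'p"
  assumes weyl_module: "weyl_module act"
begin

lemma act_one: "act 1 p = p" and act_mult: "act (a * b) p = act a (act b p)"
  and clinear_act: "clinear (act a)" and clinear_act_left: "clinear (\<lambda>a. act a p)"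
  using weyl_module by (auto simp: weyl_module_def cbilinear_def)

sublocale act: Vector_Spaces.linear scaleC scaleC "act a" for a by (fact clinear_act)
sublocale act_left: Vector_Spaces.linear scaleC scaleC "\<lambda>a. act a p" for p by (fact clinear_act_left)

text \<open>
The normally ordered monomials \<open>x\<^sup>i\<partial>\<^sup>j\<close> span the Weyl algebra, since their span contains 1 and is
stable under left multiplication by \<open>x\<close> and by \<open>\<partial>\<close>.
\<close>

lemma act_induct_normal:
  assumes sub: "csubspace N" and base: "\<And>i j. act (weyl_x ^ i) (act (weyl_del ^ j) p) \<in> N"
  shows "act a p \<in> N"
proof -
  let ?U = "cspan {weyl_x ^ i * weyl_del ^ j | i j. True}"
  have *: "g * b \<in> ?U" if "\<And>i j. g * (weyl_x ^ i * weyl_del ^ j) \<in> ?U" "b \<in> ?U" for g b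
    using that(2)
  proof (induction rule: cvec.span_induct_alt)
    case base
    show ?case by (simp add: cvec.span_zero)
  next
    case (step c x y)
    have "g * (c *\<^sub>C x) = c *\<^sub>C (g * x)"
      by transfer (simp add: weyl_scaleC_mult_right congruent_mod_refl)
    then show ?case
      using step that(1) by (auto simp: distrib_left intro!: cvec.span_add cvec.span_scale)
  qed
  have mono: "weyl_x ^ i * weyl_del ^ j \<in> ?U" for i j
    by (rule cvec.span_base) blast
  have "a \<in> ?U"
  proof (induction a rule: weyl_induct)
    case one
    show ?case using mono[of 0 0] by simp
  next
    case (x a)
    show ?case
    proof (rule *[OF _ x])
      fix i j show "weyl_x * (weyl_x ^ i * weyl_del ^ j) \<in> ?U"
        using mono[of "Suc i" j] by (simp add: mult.assoc)
    qed
  next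
    case (del a)
    show ?case
    proof (rule *[OF _ del])
      fix i j
      have "weyl_del * (weyl_x ^ i * weyl_del ^ j) = weyl_x ^ i * weyl_del ^ Suc j
         + of_nat i *\<^sub>C (weyl_x ^ (i - 1) * weyl_del ^ j)"
        by (simp add: mult.assoc[symmetric] weyl_del_x_power distrib_right weyl_mult_scaleC)
      then show "weyl_del * (weyl_x ^ i * weyl_del ^ j) \<in> ?U"
        by (metis cvec.span_add cvec.span_scale mono)
    qed
  qed (auto intro: cvec.span_add cvec.span_scale)
  then show ?thesis
  proof (induction rule: cvec.span_induct_alt)
    case (step c x y)
    then show ?case using base
      by (auto simp: act_left.add act_left.scale act_mult
          intro!: cvec.subspace_add[OF sub] cvec.subspace_scale[OF sub])
  qed (simp add: act_left.zero cvec.subspace_0[OF sub])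
qed

end

text \<open>
The value of the polynomial \<open>Q\<close> at the endomorphism \<open>f\<close>, applied to \<open>y\<close> by Horner's scheme.
\<close>

definition poly_act :: "('a::complex_vector \<Rightarrow> 'a) \<Rightarrow> complex poly \<Rightarrow> 'a \<Rightarrow> 'a"
  where "poly_act f Q y = fold_coeffs (\<lambda>a z. a *\<^sub>C y + f z) Q 0"

lemma poly_act_0: "poly_act f 0 y = 0"
  by (simp add: poly_act_def)

lemma poly_act_pCons:
  assumes "clinear f"
  shows "poly_act f (pCons a Q) y = a *\<^sub>C y + f (poly_act f Q y)"
proof -
  interpret f: Vector_Spaces.linear scaleC scaleC f by fact
  show ?thesis
    by (cases "a = 0 \<and> Q = 0") (auto simp: poly_act_def f.zero)
qed

lemma poly_act_add:
  assumes "clinear f"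
  shows "poly_act f (Q + R) y = poly_act f Q y + poly_act f R y"
proof -
  interpret f: Vector_Spaces.linear scaleC scaleC f by fact
  show ?thesis
    by (induction Q R rule: poly_induct2)
      (simp_all add: poly_act_pCons[OF assms] poly_act_0 scaleC_add_left f.add algebra_simps)
qed

lemma poly_act_smult:
  assumes "clinear f"
  shows "poly_act f (smult c Q) y = c *\<^sub>C poly_act f Q y"
proof -
  interpret f: Vector_Spaces.linear scaleC scaleC f by fact
  show ?thesis
    by (induction Q)
      (simp_all add: poly_act_pCons[OF assms] poly_act_0 scaleC_add_right scaleC_scaleC f.scale)
qed

lemma poly_act_mult:
  assumes "clinear f"
  shows "poly_act f (Q * R) y = poly_act f Q (poly_act f R y)"
proof -
  interpret f: Vector_Spaces.linear scaleC scaleC f by fact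
  show ?thesis
    by (induction Q)
      (simp_all add: poly_act_pCons[OF assms] poly_act_0 poly_act_add[OF assms]
        poly_act_smult[OF assms])
qed

lemma clinear_poly_act:
  assumes "clinear f"
  shows "clinear (poly_act f Q)"
proof -
  interpret f: Vector_Spaces.linear scaleC scaleC f by fact
  show ?thesis
  proof (rule clinearI)
    show "poly_act f Q (x + y) = poly_act f Q x + poly_act f Q y" for x y
      by (induction Q)
        (simp_all add: poly_act_pCons[OF assms] poly_act_0 scaleC_add_right f.add algebra_simps)
    show "poly_act f Q (c *\<^sub>C x) = c *\<^sub>C poly_act f Q x" for c x
      by (induction Q)
        (simp_all add: poly_act_pCons[OF assms] poly_act_0 scaleC_add_right scaleC_scaleC f.scale
          mult.commute)
  qed
qed

text \<open>
By the fundamental theorem of algebra \<open>Q\<close> splits into linear factors, each of which acts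
injectively when \<open>f\<close> has no eigenvectors.
\<close>

lemma poly_act_eq_0D:
  assumes "clinear f" and no_eigen: "\<And>z y. f y = z *\<^sub>C y \<Longrightarrow> y = 0"
    and "Q \<noteq> 0" "poly_act f Q y = 0"
  shows "y = 0"
  using assms(3,4)
proof (induction "degree Q" arbitrary: Q rule: less_induct)
  case less
  interpret f: Vector_Spaces.linear scaleC scaleC f by fact
  show ?case
  proof (cases "degree Q = 0")
    case True
    then obtain c where "Q = [:c:]" by (metis degree_eq_zeroE)
    then show ?thesis using less.prems
      by (simp add: poly_act_pCons[OF assms(1)] poly_act_0 f.zero)
  next
    case False
    then obtain z where "poly Q z = 0"
      using fundamental_theorem_of_algebra[of Q] by (auto simp: constant_degree)
    then obtain R where R: "Q = [:- z, 1:] * R" by (auto simp: poly_eq_0_iff_dvd)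
    then have "R \<noteq> 0" using less.prems by auto
    then have deg: "degree R < degree Q" unfolding R by (subst degree_mult_eq) auto
    have "f (poly_act f R y) - z *\<^sub>C poly_act f R y = 0"
      using less.prems(2) unfolding R poly_act_mult[OF assms(1)]
      by (simp add: poly_act_pCons[OF assms(1)] poly_act_0 f.zero f.add scaleC_one)
    then have "poly_act f R y = 0" using no_eigen by simp
    then show ?thesis using less.hyps[OF deg \<open>R \<noteq> 0\<close>] by simp
  qed
qed

text \<open>
The vectors \<open>r z\<close> play the role of \<open>(f - z)\<^sup>-\<^sup>1 p\<close>. Clearing denominators turns a linear relation
among them into \<open>Q(f) p = 0\<close> for a polynomial \<open>Q\<close> whose value at \<open>z\<close> is a nonzero multiple of the
coefficient of \<open>r z\<close>.
\<close>

lemma independent_resolvents: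
  assumes f: "clinear f" and no_eigen: "\<And>z y. f y = z *\<^sub>C y \<Longrightarrow> y = 0" and "p \<noteq> 0"
    and r: "\<And>z. f (r z) - z *\<^sub>C r z = p"
  shows "inj r" "cvec.independent (range r)"
proof -
  interpret f: Vector_Spaces.linear scaleC scaleC f by fact
  have rel: "c z = 0" if F: "finite F" "z \<in> F" and sum: "(\<Sum>\<mu>\<in>F. c \<mu> *\<^sub>C r \<mu>) = 0" for F c z
  proof (rule ccontr)
    assume "c z \<noteq> 0"
    define L where "L A = (\<Prod>\<mu>\<in>A. [:- \<mu>, 1:])" for A :: "complex set"
    define Q where "Q = (\<Sum>\<mu>\<in>F. smult (c \<mu>) (L (F - {\<mu>})))"
    interpret LF: Vector_Spaces.linear scaleC scaleC "poly_act f A" for A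
      by (rule clinear_poly_act[OF f])
    have sum_act: "poly_act f (sum g A) y = (\<Sum>i\<in>A. poly_act f (g i) y)" for g and A :: "complex set" and y
      by (induction A rule: infinite_finite_induct) (simp_all add: poly_act_0 poly_act_add[OF f])
    have "poly_act f (L F) (r \<mu>) = poly_act f (L (F - {\<mu>})) p" if "\<mu> \<in> F" for \<mu>
    proof -
      have "L F = L (F - {\<mu>}) * [:- \<mu>, 1:]"
        unfolding L_def using F(1) that by (subst prod.remove[of F \<mu>]) (simp_all add: mult.commute)
      moreover have "poly_act f [:- \<mu>, 1:] (r \<mu>) = p"
        using r[of \<mu>] by (simp add: poly_act_pCons[OF f] poly_act_0 f.zero scaleC_one)
      ultimately show ?thesis by (simp only: poly_act_mult[OF f])
    qed
    then have "poly_act f Q p = poly_act f (L F) (\<Sum>\<mu>\<in>F. c \<mu> *\<^sub>C r \<mu>)"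
      by (simp add: Q_def sum_act poly_act_smult[OF f] LF.sum LF.scale)
    then have "poly_act f Q p = 0" by (simp add: sum LF.zero)
    moreover have "poly Q z = c z * (\<Prod>\<mu>\<in>F - {z}. z - \<mu>)"
    proof -
      have "poly Q z = (\<Sum>\<mu>\<in>F. if \<mu> = z then c z * (\<Prod>\<mu>\<in>F - {z}. z - \<mu>) else 0)"
        unfolding Q_def L_def poly_sum using F
        by (intro sum.cong refl) (auto simp: poly_prod prod_zero_iff)
      then show ?thesis using F by simp
    qed
    then have "poly Q z \<noteq> 0" using \<open>c z \<noteq> 0\<close> F by (simp add: prod_zero_iff)
    then have "Q \<noteq> 0" by auto
    ultimately have "p = 0"
      using poly_act_eq_0D[where f = f and Q = Q and y = p] f no_eigen by metis
    then show False using \<open>p \<noteq> 0\<close> by contradiction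
  qed
  show "inj r"
  proof (rule injI, rule ccontr)
    fix z \<mu> assume "r z = r \<mu>" "z \<noteq> \<mu>"
    then show False
      using rel[of "{z, \<mu>}" z "\<lambda>\<nu>. if \<nu> = z then 1 else -1"] by (simp add: scaleC_one)
  qed
  show "cvec.independent (range r)"
    unfolding cvec.independent_explicit_module
  proof (intro allI impI)
    fix T u v assume T: "finite T" "T \<subseteq> range r" "(\<Sum>v\<in>T. u v *\<^sub>C v) = 0" "v \<in> T"
    then obtain F where F: "finite F" "T = r ` F" by (meson finite_subset_image)
    then have "(\<Sum>\<mu>\<in>F. u (r \<mu>) *\<^sub>C r \<mu>) = 0"
      using T(3) \<open>inj r\<close> by (simp add: sum.reindex inj_on_subset)
    then show "u v = 0" using rel[of F _ "\<lambda>\<mu>. u (r \<mu>)"] F T(4) by auto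
  qed
qed

text \<open>
An independent set meets each of the increasing finite-dimensional spans of \<open>b 0, \<dots>, b n\<close> in a
finite set.
\<close>

lemma countable_independent:
  fixes b :: "nat \<Rightarrow> 'a::complex_vector" and S :: "'a set"
  assumes "cspan (range b) = UNIV" "cvec.independent S"
  shows "countable S"
proof -
  have "\<exists>n. s \<in> cspan (b ` {..n})" for s
  proof -
    have "s \<in> cspan (range b)" using assms(1) by simp
    then obtain T c where "finite T" "T \<subseteq> range b" "s = (\<Sum>a\<in>T. c a *\<^sub>C a)"
      unfolding cvec.span_explicit by blast
    then have T: "finite T" "T \<subseteq> range b" "s \<in> cspan T"
      by (auto intro: cvec.span_sum cvec.span_scale cvec.span_base)
    then obtain F where "finite F" "T = b ` F" by (meson finite_subset_image)
    then have "T \<subseteq> b ` {..Max F}" by auto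
    then show ?thesis using T(3) cvec.span_mono by blast
  qed
  then have "S = (\<Union>n. S \<inter> cspan (b ` {..n}))" by auto
  moreover have "finite (S \<inter> cspan (b ` {..n}))" for n
    using cvec.independent_span_bound[of "b ` {..n}" "S \<inter> cspan (b ` {..n})"]
      cvec.independent_mono[OF assms(2)] by auto
  ultimately show ?thesis
    by (metis countable_UN countable_finite countableI_type)
qed

lemma simple_weyl_module_generated:
  assumes "simple_weyl_module act" "p \<noteq> 0"
  obtains a where "act a p = q"
proof -
  interpret weyl_representation act
    by unfold_locales (use assms in \<open>simp add: simple_weyl_module_def\<close>)
  let ?N = "range (\<lambda>a. act a p)"
  have "csubspace ?N"
    by (rule act_left.subspace_image[OF cvec.subspace_UNIV])
  moreover have "\<forall>a. \<forall>q\<in>?N. act a q \<in> ?N"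
    by (auto simp flip: act_mult)
  ultimately have "?N = {0} \<or> ?N = UNIV"
    using assms(1) unfolding simple_weyl_module_def by blast
  moreover have "p \<in> ?N" by (metis act_one rangeI)
  ultimately have "q \<in> ?N" using assms(2) by auto
  then show thesis using that by auto
qed

text \<open>
This is Schur's lemma combined with the density theorem for two vectors. By the hypothesis on
annihilators, \<open>act a p \<mapsto> act a q\<close> is a well-defined endomorphism \<open>f\<close> of the module. If \<open>f\<close> were no
scalar, then by simplicity it would have no eigenvector and every \<open>f - z\<close> would have \<open>p\<close> in its
image. That would give an independent family indexed by the complex numbers, although the module,
being cyclic over the Weyl algebra, has countable dimension (Dixmier's argument).
\<close>

lemma simple_weyl_module_schur:
  assumes simple: "simple_weyl_module act" and "p \<noteq> 0" and ann: "\<And>a. act a p = 0 \<Longrightarrow> act a q = 0"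
  shows "\<exists>c. q = c *\<^sub>C p"
proof (rule ccontr)
  assume contra: "\<not> ?thesis"
  interpret weyl_representation act
    by unfold_locales (use assms in \<open>simp add: simple_weyl_module_def\<close>)
  define f where "f y = act (SOME a. act a p = y) q" for y
  have f_act: "f (act a p) = act a q" for a
  proof -
    have "act (SOME b. act b p = act a p) p = act a p"
      by (rule someI_ex) blast
    then have "act ((SOME b. act b p = act a p) - a) p = 0"
      by (simp add: act_left.diff)
    from ann[OF this] show ?thesis by (simp add: f_def act_left.diff)
  qed
  have gen: "\<exists>a. y = act a p" for y
    using simple_weyl_module_generated[OF simple \<open>p \<noteq> 0\<close>] by metis
  have f: "clinear f"
    by (rule clinearI) (metis gen f_act act_left.add, metis gen f_act act_left.scale)
  have f_equiv: "f (act a y) = act a (f y)" for a y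
    by (metis gen f_act act_mult)
  have fp: "f p = q" using f_act[of 1] by (simp add: act_one)
  have no_eigen: "y = 0" if "f y = z *\<^sub>C y" for z y
  proof (rule ccontr)
    assume "y \<noteq> 0"
    then obtain a where a: "act a y = p"
      using simple_weyl_module_generated[OF simple] by metis
    have "q = f (act a y)" by (simp add: a fp)
    also have "\<dots> = act a (f y)" by (rule f_equiv)
    also have "\<dots> = z *\<^sub>C p" by (simp add: that act.scale a)
    finally show False using contra by blast
  qed
  have "\<exists>b. act b (q - z *\<^sub>C p) = p" for z
    using contra simple_weyl_module_generated[OF simple] by (metis eq_iff_diff_eq_0)
  then obtain b where b: "\<And>z. act (b z) (q - z *\<^sub>C p) = p" by metis
  have r: "f (act (b z) p) - z *\<^sub>C act (b z) p = p" for z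
    using b[of z] by (simp add: f_act act.diff act.scale)
  note res = independent_resolvents[OF f no_eigen \<open>p \<noteq> 0\<close> r]
  define g where "g n = (case prod_decode n of (i, j) \<Rightarrow> act (weyl_x ^ i) (act (weyl_del ^ j) p))" for n
  have "act a p \<in> cspan (range g)" for a
  proof (rule act_induct_normal[OF cvec.subspace_span])
    fix i j
    have "act (weyl_x ^ i) (act (weyl_del ^ j) p) = g (prod_encode (i, j))"
      by (simp add: g_def)
    then show "act (weyl_x ^ i) (act (weyl_del ^ j) p) \<in> cspan (range g)"
      by (metis cvec.span_base rangeI)
  qed
  then have "cspan (range g) = UNIV" using gen by (metis UNIV_eq_I)
  then have "countable (range (\<lambda>z. act (b z) p))"
    using res(2) by (rule countable_independent)
  then have "countable (UNIV :: complex set)"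
    using res(1) by (rule countable_image_inj_on)
  then have "countable (range complex_of_real)"
    by (rule countable_subset[rotated]) simp
  then have "countable (UNIV :: real set)"
    by (rule countable_image_inj_on) (simp add: inj_def)
  then show False using uncountable_UNIV_real by simp
qed

text \<open>
Shortening of tensors. Take a nonzero element of \<open>N\<close> with the least number of linearly independent
second factors. If some \<open>a\<close> annihilated one of its first factors but not another one, then applying
\<open>a \<otimes> h\<close> would give a shorter nonzero element, as \<open>h\<close> preserves linear independence. So by
\<open>simple_weyl_module_schur\<close> all first factors are proportional, the element is a pure tensor \<open>p\<^sub>1 \<otimes> u\<close>, and the
elements \<open>a p\<^sub>1 \<otimes> h u\<close> of \<open>N\<close> fill \<open>P \<otimes> h u\<close>.
\<close>

lemma simple_weyl_module_tensor_pure: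
  fixes act :: "weyl \<Rightarrow> 'p::complex_vector \<Rightarrow> 'p" and h :: "'v::complex_vector \<Rightarrow> 'v"
  assumes simple: "simple_weyl_module act" and h: "clinear h" "inj h"
    and N: "csubspace N" "N \<noteq> {0}"
    and stable: "\<And>a t. t \<in> N \<Longrightarrow> tensor_map (act a) h t \<in> N"
  obtains u where "u \<noteq> 0" "\<And>p. p \<otimes>\<^sub>C u \<in> N"
proof -
  interpret weyl_representation act
    by unfold_locales (use simple in \<open>simp add: simple_weyl_module_def\<close>)
  interpret h: Vector_Spaces.linear scaleC scaleC h by fact
  interpret map: Vector_Spaces.linear scaleC scaleC "tensor_map (act a) h" for a
    by (rule clinear_tensor_map[OF clinear_act h(1)])
  define has_rank where "has_rank n \<longleftrightarrow> (\<exists>S f. finite S \<and> cvec.independent S \<and> card S = n \<and>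
      (\<exists>v\<in>S. f v \<noteq> 0) \<and> (\<Sum>v\<in>S. f v \<otimes>\<^sub>C v) \<in> N)" for n
  obtain t where "t \<in> N" "t \<noteq> 0"
    using N cvec.subspace_0 by blast
  then have "\<exists>n. has_rank n"
  proof -
    obtain S f where S: "finite S" "cvec.independent S" "t = (\<Sum>v\<in>S. f v \<otimes>\<^sub>C v)"
      by (rule tensor_expansion)
    moreover from this have "\<exists>v\<in>S. f v \<noteq> 0"
      using \<open>t \<noteq> 0\<close> by (intro ccontr[of "\<exists>v\<in>S. f v \<noteq> 0"]) (simp add: pure_left.zero)
    ultimately show ?thesis
      using \<open>t \<in> N\<close> unfolding has_rank_def by (intro exI[of _ "card S"] exI[of _ S] exI[of _ f]) simp
  qed
  then have "has_rank (LEAST n. has_rank n)" by (rule LeastI_ex)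
  then obtain S f v1 where S: "finite S" "cvec.independent S" "card S = (LEAST n. has_rank n)"
    and v1: "v1 \<in> S" "f v1 \<noteq> 0" and mem: "(\<Sum>v\<in>S. f v \<otimes>\<^sub>C v) \<in> N"
    unfolding has_rank_def by blast
  have image: "(\<Sum>v\<in>S. act a (f v) \<otimes>\<^sub>C h v) \<in> N" for a
    using stable[OF mem, of a] by (simp add: map.sum tensor_map_pure[OF clinear_act h(1)])
  \<comment> \<open>Minimality enters here: any other relation between annihilators would shorten the tensor.\<close>
  have "\<exists>c. f v = c *\<^sub>C f v1" if "v \<in> S" for v
  proof (rule simple_weyl_module_schur[OF simple v1(2)], rule ccontr)
    fix a assume a: "act a (f v1) = 0" "act a (f v) \<noteq> 0"
    define S' where "S' = h ` (S - {v1})"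
    have inv: "inv h (h x) = x" for x using h(2) by simp
    have "(\<Sum>w\<in>S'. act a (f (inv h w)) \<otimes>\<^sub>C w) = (\<Sum>v\<in>S - {v1}. act a (f v) \<otimes>\<^sub>C h v)"
      unfolding S'_def using h(2) by (subst sum.reindex) (simp_all add: inj_on_subset[OF h(2)] inv)
    also have "\<dots> = (\<Sum>v\<in>S. act a (f v) \<otimes>\<^sub>C h v)"
      using S(1) v1(1) a(1) by (simp add: sum.remove[of S v1] pure_left.zero)
    finally have "(\<Sum>w\<in>S'. act a (f (inv h w)) \<otimes>\<^sub>C w) \<in> N" using image by simp
    moreover have "finite S'" using S(1) by (simp add: S'_def)
    moreover have "cvec.independent S'"
      unfolding S'_def
      by (rule h.independent_injective_image)
        (use cvec.independent_mono[OF S(2) Diff_subset] inj_on_subset[OF h(2) subset_UNIV] in auto)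
    moreover have "\<exists>w\<in>S'. act a (f (inv h w)) \<noteq> 0"
      using a that by (intro bexI[of _ "h v"]) (auto simp: S'_def inv)
    ultimately have "has_rank (card S')" unfolding has_rank_def
      by (intro exI[of _ S'] exI[of _ "\<lambda>w. act a (f (inv h w))"]) blast
    moreover have "card S' < card S"
      unfolding S'_def using S(1) v1(1) h(2)
      by (metis card_Diff1_less card_image_le finite_Diff order_le_less_trans)
    ultimately show False
      using S(3) not_less_Least by metis
  qed
  then obtain c where c: "\<And>v. v \<in> S \<Longrightarrow> f v = c v *\<^sub>C f v1" by metis
  define u where "u = (\<Sum>v\<in>S. c v *\<^sub>C v)"
  have sum: "(\<Sum>v\<in>S. f v \<otimes>\<^sub>C v) = f v1 \<otimes>\<^sub>C u"
    unfolding u_def pure_right.sum pure_right.scale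
    by (intro sum.cong refl) (metis c pure_left.scale)
  have "u \<noteq> 0"
  proof
    assume "u = 0"
    then have "f v1 = 0"
      using tensor_sum_eq_0D[OF S(2,1) _ v1(1)] sum by (simp add: pure_right.zero)
    with v1(2) show False by contradiction
  qed
  show thesis
  proof (rule that)
    show "h u \<noteq> 0" using \<open>u \<noteq> 0\<close> h(2) by (metis h.zero injD)
    fix p
    obtain a where "act a (f v1) = p"
      using simple_weyl_module_generated[OF simple v1(2)] by metis
    then show "p \<otimes>\<^sub>C h u \<in> N"
      using stable[OF mem, of a] by (simp add: sum tensor_map_pure[OF clinear_act h(1)])
  qed
qed

section \<open>The Witt module structure on the tensor product\<close>

lemma (in weyl_representation) weyl_representation_tensor:
  "weyl_representation (\<lambda>a. tensor_map (act a) (\<lambda>v::'v::complex_vector. v))"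
proof -
  note id = clinear_ident[where 'a = 'v]
  interpret map: Vector_Spaces.linear scaleC scaleC "tensor_map (act a) (\<lambda>v::'v. v)" for a
    by (rule clinear_tensor_map[OF clinear_act id])
  note pure = tensor_map_pure[OF clinear_act id]
  have add: "tensor_map (act (a + b)) (\<lambda>v. v) t = tensor_map (act a) (\<lambda>v. v) t + tensor_map (act b) (\<lambda>v::'v. v) t"
    for a b t
  proof (induction t rule: tensor_induct)
    case (pure x y)
    show ?case unfolding tensor_map_pure[OF clinear_act id]
      by (simp add: act_left.add pure_left.add)
  qed (simp_all add: map.add map.scale scaleC_add_right)
  have scale: "tensor_map (act (c *\<^sub>C a)) (\<lambda>v. v) t = c *\<^sub>C tensor_map (act a) (\<lambda>v::'v. v) t" for c a t
  proof (induction t rule: tensor_induct)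
    case (pure x y)
    show ?case unfolding tensor_map_pure[OF clinear_act id]
      by (simp add: act_left.scale pure_left.scale)
  qed (simp_all add: map.add map.scale scaleC_add_right scaleC_scaleC mult.commute)
  have "tensor_map (act 1) (\<lambda>v::'v. v) t = t" for t
    by (induction t rule: tensor_induct) (simp_all only: act_one tensor_map_id)
  moreover have "tensor_map (act (a * b)) (\<lambda>v::'v. v) t = tensor_map (act a) (\<lambda>v. v) (tensor_map (act b) (\<lambda>v. v) t)" for a b t
    by (induction t rule: tensor_induct) (simp_all only: act_mult tensor_map_tensor_map[OF clinear_act id clinear_act id])
  ultimately show ?thesis
    by unfold_locales
      (auto simp: weyl_module_def cbilinear_def intro!: clinearI map.add map.scale add scale)
qed

lemma witt_induct [case_names basis scale add]:
  assumes "\<And>k. Q (wd (int k - 1))" and scale: "\<And>c D. Q D \<Longrightarrow> Q (c *\<^sub>C D)"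
    and add: "\<And>D E. Q D \<Longrightarrow> Q E \<Longrightarrow> Q (D + E)"
  shows "Q D"
proof -
  have "Q (0 *\<^sub>C wd (int 0 - 1))" by (intro scale assms)
  then have zero: "Q 0" by simp
  have "Q (\<Sum>k\<in>A. wcoeff D k *\<^sub>C wd (int k - 1))" for A
    by (induction A rule: infinite_finite_induct) (auto intro: zero add scale assms)
  then show ?thesis using witt_expansion[of D] by metis
qed

lemma derivation_add: "derivation D (p + q) = derivation D p + derivation D q"
  and derivation_smult: "derivation D (smult c p) = smult c (derivation D p)"
  using derivation[of D] by blast+

global_interpretation bracket_left: Vector_Spaces.linear scaleC scaleC "\<lambda>D. bracket D E" for E
  by (rule clinearI) (simp_all add: bracket.rep_eq plus_witt.rep_eq scaleC_witt.rep_eq fun_eq_iff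
      derivation_add derivation_smult smult_diff_right flip: derivation_inject)

global_interpretation bracket_right: Vector_Spaces.linear scaleC scaleC "\<lambda>E. bracket D E" for D
  by (rule clinearI) (simp_all add: bracket.rep_eq plus_witt.rep_eq scaleC_witt.rep_eq fun_eq_iff
      derivation_add derivation_smult smult_diff_right flip: derivation_inject)

lemma wd_in_borel: "wd (int r) \<in> borel_b"
  unfolding borel_b_def by (rule cvec.span_base) auto

locale tensor_representation = weyl_representation act
  for act :: "weyl \<Rightarrow> 'p::complex_vector \<Rightarrow> 'p" +
  fixes rho :: "witt \<Rightarrow> 'v::complex_vector \<Rightarrow> 'v"
  assumes lie: "lie_module borel_b rho"
begin

lemma clinear_rho: "D \<in> borel_b \<Longrightarrow> clinear (rho D)"
  using lie by (simp add: lie_module_def)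

lemma rho_commutator:
  "rho (wd (int r)) (rho (wd (int s)) v) - rho (wd (int s)) (rho (wd (int r)) v)
    = (of_nat s - of_nat r) *\<^sub>C rho (wd (int (r + s))) v"
proof -
  have "rho (wd (int r)) (rho (wd (int s)) v) - rho (wd (int s)) (rho (wd (int r)) v)
      = rho (bracket (wd (int r)) (wd (int s))) v"
    using lie wd_in_borel unfolding lie_module_def by simp
  also have "\<dots> = rho (of_int (int s - int r) *\<^sub>C wd (int (r + s))) v"
    by (simp add: bracket_wd)
  also have "\<dots> = of_int (int s - int r) *\<^sub>C rho (wd (int (r + s))) v"
    using lie wd_in_borel[of "r + s"] unfolding lie_module_def by blast
  finally show ?thesis by simp
qed

abbreviation tact :: "weyl \<Rightarrow> ('p, 'v) tensor \<Rightarrow> ('p, 'v) tensor"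
  where "tact a \<equiv> tensor_map (act a) (\<lambda>v. v)"

sublocale tact: weyl_representation tact
  by (rule weyl_representation_tensor)

text \<open>
  The operators written \<open>e\<^sub>r\<close> in \<open>witt_realization\<close>, for the tensor module.
\<close>

definition symbol :: "nat \<Rightarrow> ('p, 'v) tensor \<Rightarrow> ('p, 'v) tensor"
  where "symbol r = (case r of 0 \<Rightarrow> tact weyl_del | Suc s \<Rightarrow> tensor_map (\<lambda>p. p) (rho (wd (int s))))"

lemma symbol_0: "symbol 0 = tact weyl_del"
  and symbol_Suc: "symbol (Suc s) = tensor_map (\<lambda>p. p) (rho (wd (int s)))"
  by (simp_all add: symbol_def)

lemma clinear_symbol: "clinear (symbol r)"
  by (cases r) (auto simp: symbol_0 symbol_Suc intro!: clinear_tensor_map clinear_act clinear_ident clinear_rho wd_in_borel)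

lemma symbol_Suc_pure: "symbol (Suc s) (p \<otimes>\<^sub>C v) = p \<otimes>\<^sub>C rho (wd (int s)) v"
  by (simp add: symbol_Suc tensor_map_pure clinear_ident clinear_rho wd_in_borel)

lemma tact_symbol: "tact a (symbol (Suc s) t) = tensor_map (act a) (rho (wd (int s))) t"
  and symbol_tact: "symbol (Suc s) (tact a t) = tensor_map (act a) (rho (wd (int s))) t"
  by (simp_all add: symbol_Suc tensor_map_tensor_map clinear_act clinear_ident clinear_rho wd_in_borel)

sublocale witt_realization "tact weyl_x" symbol
proof (rule witt_realization.intro)
  show "clinear (tact weyl_x)" by (rule tact.clinear_act)
  show "clinear (symbol r)" for r by (rule clinear_symbol)
  show "symbol 0 (tact weyl_x t) = tact weyl_x (symbol 0 t) + t" for t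
  proof -
    have "tact (weyl_del * weyl_x - weyl_x * weyl_del) t = t"
      by (simp only: weyl_relation tact.act_one)
    then show ?thesis
      by (simp add: tact.act_left.diff tact.act_mult symbol_0 algebra_simps)
  qed
  show "symbol (Suc r) (tact weyl_x t) = tact weyl_x (symbol (Suc r) t)" for r t
    by (simp add: tact_symbol symbol_tact)
qed

lemma tact_x_power: "(tact weyl_x ^^ n) t = tact (weyl_x ^ n) t"
  by (induction n) (simp_all add: tact.act_one tact.act_mult)

lemma phi_action_eq_X: "phi_action act rho (int k - 1) t = X k t"
proof (cases k)
  case 0
  then show ?thesis by (simp add: phi_action_def id_def X_def symbol_0 scaleC_one)
next
  case (Suc m)
  have "X (Suc m) t = tact (weyl_x ^ Suc m * weyl_del) t +
      (\<Sum>r\<le>m. of_nat (Suc m choose Suc r) *\<^sub>C tact (weyl_x ^ (m - r)) (symbol (Suc r) t))"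
    unfolding X_def tact.act_mult symbol_0[symmetric]
    by (subst sum.atMost_Suc_shift) (simp add: tact_x_power scaleC_one del: power_Suc funpow.simps)
  then show ?thesis
    by (simp add: Suc phi_action_def id_def tact_symbol atMost_atLeast0 del: power_Suc)
qed

lemma symbol_commutes: "symbol 0 (symbol s t) = symbol s (symbol 0 t)"
  by (cases s) (simp_all add: symbol_0 tact_symbol symbol_tact)

lemma symbol_commutator:
  "symbol (Suc r) (symbol (Suc s) t) - symbol (Suc s) (symbol (Suc r) t)
    = (of_nat s - of_nat r) *\<^sub>C symbol (Suc (r + s)) t"
proof (induction t rule: tensor_induct)
  case (pure p v)
  show ?case
    using rho_commutator[of r s v]
    by (simp only: symbol_Suc_pure flip: pure_right.diff pure_right.scale)
next
  case (scale c t)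
  then show ?case
    by (simp only: e.scale scaleC_scaleC mult.commute[of _ c] flip: cvec.scale_right_diff_distrib)
next
  case (add s t)
  then show ?case
    by (simp only: e.add scaleC_add_right) (metis add_diff_add)
qed

lemma T_action_eq:
  "wdegree D \<le> n \<Longrightarrow> T_action act rho D t = (\<Sum>k\<le>n. wcoeff D k *\<^sub>C X k t)"
  unfolding T_action_def phi_action_eq_X
  by (intro sum.mono_neutral_left) (auto simp: wcoeff_def wdegree_def coeff_eq_0)

lemma T_action_wd_eq_X: "T_action act rho (wd (int k - 1)) t = X k t"
  by (simp add: T_action_wd phi_action_eq_X)

lemma T_action_add: "T_action act rho (D + E) t = T_action act rho D t + T_action act rho E t"
proof -
  let ?n = "max (wdegree (D + E)) (max (wdegree D) (wdegree E))"
  show ?thesis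
    by (simp add: T_action_eq[of _ ?n] wcoeff_def plus_witt.rep_eq scaleC_add_left sum.distrib)
qed

lemma T_action_scale: "T_action act rho (c *\<^sub>C D) t = c *\<^sub>C T_action act rho D t"
proof -
  let ?n = "max (wdegree (c *\<^sub>C D)) (wdegree D)"
  show ?thesis
    by (simp add: T_action_eq[of _ ?n] wcoeff_def scaleC_witt.rep_eq scaleC_scaleC
        cvec.scale_sum_right)
qed

lemma clinear_T_action: "clinear (T_action act rho D)"
proof -
  interpret X: Vector_Spaces.linear scaleC scaleC "X k" for k by (rule clinear_X)
  show ?thesis
    by (rule clinearI)
      (simp_all add: T_action_eq[OF order_refl] X.add X.scale scaleC_add_right sum.distrib
        scaleC_scaleC cvec.scale_sum_right mult.commute)
qed

sublocale T: Vector_Spaces.linear scaleC scaleC "T_action act rho D" for D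
  by (rule clinear_T_action)

lemma T_action_bracket_wd:
  "T_action act rho (bracket (wd (int j - 1)) (wd (int k - 1))) t = X j (X k t) - X k (X j t)"
proof (cases "j + k")
  \<comment> \<open>Here \<open>bracket_wd\<close> yields the index -2, which has no meaning, but with coefficient 0.\<close>
  case 0
  then show ?thesis
    using T_action_scale[of 0] by (simp add: bracket_wd)
next
  case (Suc n)
  then have index: "int j - 1 + (int k - 1) = int (j + k - 1) - 1" by linarith
  have scalar: "of_int (int k - 1 - (int j - 1)) = (of_nat k - of_nat j :: complex)" by simp
  have "bracket (wd (int j - 1)) (wd (int k - 1))
      = (of_nat k - of_nat j) *\<^sub>C wd (int (j + k - 1) - 1)"
    unfolding scalar[symmetric] index[symmetric] by (rule bracket_wd) auto
  then show ?thesis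
    by (simp only: T_action_scale T_action_wd_eq_X
        X_commutator[OF symbol_commutes symbol_commutator])
qed

text \<open>
Both sides are bilinear in \<open>D\<close> and \<open>E\<close>, so the basis vectors suffice.
\<close>

lemma T_action_bracket:
  "T_action act rho (bracket D E) t =
    T_action act rho D (T_action act rho E t) - T_action act rho E (T_action act rho D t)"
proof (induction D rule: witt_induct)
  case (basis j)
  show ?case
  proof (induction E rule: witt_induct)
    case (basis k)
    show ?case by (simp only: T_action_bracket_wd T_action_wd_eq_X)
  next
    case (scale c E)
    then show ?case
      by (simp only: bracket_right.scale T_action_scale T.scale cvec.scale_right_diff_distrib)
  next
    case (add E F)
    then show ?case by (simp add: bracket_right.add T_action_add T.add)
  qed
next
  case (scale c D)
  then show ?case
    by (simp only: bracket_left.scale T_action_scale T.scale cvec.scale_right_diff_distrib)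
next
  case (add D F)
  then show ?case by (simp add: bracket_left.add T_action_add T.add)
qed

lemma lie_module_T_action: "lie_module UNIV (T_action act rho)"
  unfolding lie_module_def
  by (simp add: clinear_T_action T_action_add T_action_scale T_action_bracket)

section \<open>Simplicity\<close>

text \<open>
The key step. With \<open>R = l + 1\<close>, \<open>mixed_difference_X_X\<close> expresses \<open>x\<^sup>i \<otimes> d\<^sub>l\<^sup>2\<close> through products of two
operators \<open>X\<close>, and \<open>\<partial> \<otimes> 1\<close> is \<open>X 0\<close>. So all \<open>x\<^sup>i\<partial>\<^sup>j \<otimes> d\<^sub>l\<^sup>2\<close> preserve a subspace that is stable
under every \<open>X k\<close>, and these elements span \<open>\<DD> \<otimes> d\<^sub>l\<^sup>2\<close>.
\<close>

lemma X_stable_imp_tact_stable: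
  assumes "l > 0" and vanish: "\<And>i v. i > int l \<Longrightarrow> rho (wd i) v = 0"
    and N: "csubspace N" and stable: "\<And>k t. t \<in> N \<Longrightarrow> X k t \<in> N" and "t \<in> N"
  shows "tact a (symbol (Suc l) (symbol (Suc l) t)) \<in> N"
proof (rule tact.act_induct_normal[OF N])
  fix i j
  define s where "s = tact (weyl_del ^ j) t"
  have "s \<in> N"
    unfolding s_def
  proof (induction j)
    case (Suc j)
    have "tact (weyl_del ^ Suc j) t = X 0 (tact (weyl_del ^ j) t)"
      by (simp add: X_def symbol_0 tact.act_mult scaleC_one)
    then show ?case using stable[OF Suc] by simp
  qed (simp add: tact.act_one \<open>t \<in> N\<close>)
  have zero: "symbol r s = 0" if "r > Suc l" for r s
  proof (cases r)
    case (Suc q)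
    then have "rho (wd (int q)) v = 0" for v using that by (intro vanish) simp
    then show ?thesis
      by (induction s rule: tensor_induct)
        (simp_all add: Suc symbol_Suc_pure pure_right.zero e.scale e.add)
  qed (use that in simp)
  let ?c = "(-1) ^ Suc l * of_nat ((2 * Suc l) choose Suc l) :: complex"
  have "mixed_difference (2 * Suc l) (\<lambda>j k. X j (X k s)) i 0 \<in> N"
    by (intro mixed_difference_mem N stable \<open>s \<in> N\<close>)
  then have "?c *\<^sub>C tact (weyl_x ^ i) (symbol (Suc l) (symbol (Suc l) s)) \<in> N"
    using mixed_difference_X_X[of "Suc l" s i] zero \<open>l > 0\<close> by (simp only: tact_x_power)
  then have "inverse ?c *\<^sub>C ?c *\<^sub>C tact (weyl_x ^ i) (symbol (Suc l) (symbol (Suc l) s)) \<in> N"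
    by (rule cvec.subspace_scale[OF N])
  moreover have c: "?c \<noteq> 0"
    using zero_less_binomial[of "Suc l" "2 * Suc l"] by (simp del: binomial_Suc_Suc)
  ultimately have "tact (weyl_x ^ i) (symbol (Suc l) (symbol (Suc l) s)) \<in> N"
    by (simp only: scaleC_scaleC left_inverse[OF c] scaleC_one)
  then show "tact (weyl_x ^ i) (tact (weyl_del ^ j) (symbol (Suc l) (symbol (Suc l) t))) \<in> N"
    by (simp add: s_def symbol_tact tact_symbol[symmetric])
qed

text \<open>
The vectors \<open>v\<close> with \<open>P \<otimes> v \<subseteq> N\<close> form a \<open>\<bb>\<close>-submodule: in the expansion of \<open>X (m + 1) (p \<otimes> v)\<close> the
last term is \<open>p \<otimes> d\<^sub>m v\<close>, and the second factors of the others are \<open>v\<close> itself and \<open>d\<^sub>r v\<close> with \<open>r < m\<close>,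
which induction covers.
\<close>

lemma X_stable_slices_submodule:
  assumes N: "csubspace N" and stable: "\<And>k t. t \<in> N \<Longrightarrow> X k t \<in> N"
    and v: "\<And>p. p \<otimes>\<^sub>C v \<in> N" and "D \<in> borel_b"
  shows "p \<otimes>\<^sub>C rho D v \<in> N"
proof -
  have gen: "p \<otimes>\<^sub>C rho (wd (int m)) v \<in> N" for m p
  proof (induction m arbitrary: p rule: less_induct)
    case (less m)
    have "X (Suc m) (p \<otimes>\<^sub>C v) = (\<Sum>r\<le>m. of_nat (Suc m choose r) *\<^sub>C
        tact (weyl_x ^ (Suc m - r)) (symbol r (p \<otimes>\<^sub>C v))) + p \<otimes>\<^sub>C rho (wd (int m)) v"
      by (simp add: X_def tact_x_power tact.act_one symbol_Suc_pure scaleC_one)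
    moreover have "tact a (symbol r (p \<otimes>\<^sub>C v)) \<in> N" if "r \<le> m" for a r
    proof (cases r)
      case 0
      then show ?thesis
        using v by (simp add: symbol_0 tensor_map_pure clinear_act clinear_ident)
    next
      case (Suc q)
      then show ?thesis
        using less[of q] that by (simp add: symbol_Suc_pure tensor_map_pure clinear_act clinear_ident)
    qed
    ultimately show ?case
      using stable[OF v[of p], of "Suc m"]
      by (metis (no_types, lifting) N add_diff_cancel_left' atMost_iff cvec.subspace_diff
          cvec.subspace_scale cvec.subspace_sum)
  qed
  \<comment> \<open>\<open>rho\<close> is additive only on \<open>borel_b\<close>, so membership is carried through the induction.\<close>
  have "D \<in> borel_b \<and> p \<otimes>\<^sub>C rho D v \<in> N"
    using \<open>D \<in> borel_b\<close> unfolding borel_b_def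
  proof (induction rule: cvec.span_induct_alt)
    case base
    have "rho (0 *\<^sub>C wd (int 0)) v = 0 *\<^sub>C rho (wd (int 0)) v"
      using lie wd_in_borel[of 0] unfolding lie_module_def by blast
    then show ?case
      using N by (simp add: cvec.span_zero pure_right.zero cvec.subspace_0)
  next
    case (step c x y)
    then obtain r where x: "x = wd (int r)" by (auto elim: nonneg_int_cases)
    have y: "y \<in> borel_b" using step by (simp add: borel_b_def)
    have cx: "c *\<^sub>C x \<in> borel_b" unfolding x borel_b_def
      using wd_in_borel[of r] by (intro cvec.span_scale) (simp add: borel_b_def)
    have "rho (c *\<^sub>C x + y) v = c *\<^sub>C rho x v + rho y v"
      using lie cx y wd_in_borel[of r] by (simp add: lie_module_def x)
    then have "p \<otimes>\<^sub>C rho (c *\<^sub>C x + y) v \<in> N"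
      using step gen[of p r] N
      by (simp add: x pure_right.add pure_right.scale cvec.subspace_add cvec.subspace_scale)
    then show ?case
      using cx y by (simp add: borel_b_def cvec.span_add)
  qed
  then show ?thesis ..
qed

end

theorem theorem4p3:
  fixes act :: "weyl \<Rightarrow> 'p::complex_vector \<Rightarrow> 'p"
    and rho :: "witt \<Rightarrow> 'v::complex_vector \<Rightarrow> 'v"
  assumes "simple_weyl_module act"
    and "simple_lie_module borel_b rho"
    and "\<exists>l::nat. l > 0 \<and> inj (rho (wd (int l))) \<and> (\<forall>i>int l. \<forall>v. rho (wd i) v = 0)"
  shows "simple_lie_module UNIV (T_action act rho)"
proof -
  obtain l where l: "l > 0" "inj (rho (wd (int l)))" "\<And>i v. i > int l \<Longrightarrow> rho (wd i) v = 0"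
    using assms(3) by blast
  interpret tensor_representation act rho
    by unfold_locales (use assms in \<open>auto simp: simple_weyl_module_def simple_lie_module_def\<close>)
  let ?d = "rho (wd (int l))"
  have d: "clinear ?d" by (rule clinear_rho[OF wd_in_borel])
  have d2: "clinear (\<lambda>v. ?d (?d v))" "inj (\<lambda>v. ?d (?d v))"
    using clinear_compose[OF d d] l(2) by (auto simp: inj_def)
  have simple: "N = UNIV" if N: "csubspace N" "N \<noteq> {0}"
    and T: "\<And>D t. t \<in> N \<Longrightarrow> T_action act rho D t \<in> N" for N
  proof -
    have X: "X k t \<in> N" if "t \<in> N" for k t
      using T[OF that, of "wd (int k - 1)"] by (simp add: T_action_wd_eq_X)
    have "tensor_map (act a) (\<lambda>v. ?d (?d v)) t \<in> N" if "t \<in> N" for a t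
    proof -
      have "tact a (symbol (Suc l) (symbol (Suc l) t)) = tensor_map (act a) (\<lambda>v. ?d (?d v)) t"
        by (simp add: tact_symbol) (simp add: symbol_Suc tensor_map_tensor_map clinear_act clinear_ident d)
      then show ?thesis
        using X_stable_imp_tact_stable[OF l(1,3) N(1) X that, of a] by simp
    qed
    then obtain u where u: "u \<noteq> 0" "\<And>p. p \<otimes>\<^sub>C u \<in> N"
      using simple_weyl_module_tensor_pure[OF assms(1) d2 N] by metis
    define V where "V = {v. \<forall>p. p \<otimes>\<^sub>C v \<in> N}"
    have "csubspace V"
      unfolding V_def using N(1)
      by (auto intro!: cvec.subspaceI simp: pure_right.zero pure_right.add pure_right.scale
          cvec.subspace_0 cvec.subspace_add cvec.subspace_scale)
    moreover have "\<forall>D\<in>borel_b. \<forall>v\<in>V. rho D v \<in> V"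
      using X_stable_slices_submodule[OF N(1) X] by (auto simp: V_def)
    ultimately have "V = {0} \<or> V = UNIV"
      using assms(2) unfolding simple_lie_module_def by blast
    then have "V = UNIV" using u by (auto simp: V_def)
    then have pure: "p \<otimes>\<^sub>C v \<in> N" for p v by (auto simp: V_def)
    have "t \<in> N" for t
      by (induction t rule: tensor_induct)
        (use N(1) in \<open>auto intro: pure cvec.subspace_add cvec.subspace_scale\<close>)
    then show ?thesis by blast
  qed
  obtain p :: 'p and v :: 'v where "p \<noteq> 0" "v \<noteq> 0"
    using assms(1,2) unfolding simple_weyl_module_def simple_lie_module_def by blast
  then have "p \<otimes>\<^sub>C v \<noteq> 0" using pure_tensor_eq_0D by blast
  then have "(UNIV :: ('p, 'v) tensor set) \<noteq> {0}" by blast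
  then show ?thesis
    unfolding simple_lie_module_def using lie_module_T_action simple by blast
qed

end
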